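(* Let $D$ be a division ring with center $F$, and let $G$ be an ascendant subgroup of $D^*$. Suppose that $F$ is a locally finite field. If $G$ is radical over $F$, then $G$ is central, i.e. $G\subseteq F$.
   Context: $D^*=D\setminus\{0\}$. A locally finite field is a field in which every finite subset generates a finite subfield. A subgroup $H$ of a group $X$ is ascendant in $X$ if there is an ordinal $\gamma$ and a family of subgroups $(H_\alpha)_{\alpha\le\gamma}$ with $H_0=H$, $H_\gamma=X$, $H_\alpha\trianglelefteq H_{\alpha+1}$ for all $\alpha<\gamma$, and $H_\lambda=\bigcup_{\alpha<\lambda}H_\alpha$ for every limit ordinal $\lambda\le\gamma$. $G$ is radical over $F$ if for every $x\in G$ there is a positive integer $m(x)$ with $x^{m(x)}\in F$. *)

theory Defs
  imports "HOL-Algebra.Algebra"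
begin

locale skew_field = ring +
  assumes one_not_zero: "\<one> \<noteq> \<zero>"
    and skew_field_Units: "Units R = carrier R - {\<zero>}"

definition ring_center :: "('a, 'b) ring_scheme \<Rightarrow> 'a set" where
  "ring_center R = {z \<in> carrier R. \<forall>x \<in> carrier R. z \<otimes>\<^bsub>R\<^esub> x = x \<otimes>\<^bsub>R\<^esub> z}"

definition locally_finite_field :: "('a, 'b) ring_scheme \<Rightarrow> bool" where
  "locally_finite_field K \<longleftrightarrow>
     field K \<and> (\<forall>S \<subseteq> carrier K. finite S \<longrightarrow> finite (generate_field K S))"

definition radical_over :: "('a, 'b) ring_scheme \<Rightarrow> 'a set \<Rightarrow> 'a set \<Rightarrow> bool" where
  "radical_over R G K \<longleftrightarrow> (\<forall>x \<in> G. \<exists>m::nat. m > 0 \<and> x [^]\<^bsub>R\<^esub> m \<in> K)"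


text \<open>
  The ordinals \<open>\<alpha> \<le> \<gamma>\<close> are represented by the elements of the field of a well-order \<open>r\<close>
  with greatest element \<open>\<gamma>\<close>: the ordinal 0 is the least element of the field, \<open>\<alpha> + 1\<close> is
  \<open>wo_rel.suc r {\<alpha>}\<close>, and \<open>\<alpha> < \<beta>\<close> is \<open>\<alpha> \<in> underS r \<beta>\<close>.
\<close>

definition limit_elem :: "'i rel \<Rightarrow> 'i \<Rightarrow> bool" where
  "limit_elem r l \<longleftrightarrow>
     l \<in> Field r \<and> underS r l \<noteq> {} \<and> (\<forall>\<alpha> \<in> underS r l. wo_rel.suc r {\<alpha>} \<noteq> l)"

definition ascendant_series ::
  "'i rel \<Rightarrow> 'i \<Rightarrow> ('i \<Rightarrow> 'a set) \<Rightarrow> 'a set \<Rightarrow> ('a, 'b) monoid_scheme \<Rightarrow> bool" where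
  "ascendant_series r \<gamma> Hs H E \<longleftrightarrow>
     Well_order r \<and> \<gamma> \<in> Field r \<and> (\<forall>\<alpha> \<in> Field r. (\<alpha>, \<gamma>) \<in> r) \<and>
     (\<forall>\<alpha> \<in> Field r. subgroup (Hs \<alpha>) E) \<and>
     Hs (wo_rel.minim r (Field r)) = H \<and>
     Hs \<gamma> = carrier E \<and>
     (\<forall>\<alpha> \<in> underS r \<gamma>. Hs \<alpha> \<lhd> E\<lparr>carrier := Hs (wo_rel.suc r {\<alpha>})\<rparr>) \<and>
     (\<forall>l. limit_elem r l \<longrightarrow> Hs l = (\<Union>\<alpha> \<in> underS r l. Hs \<alpha>))"

text \<open>
  A HOL definition cannot quantify over the index type of the series, so it is fixed to be the
  type of sets of group elements. Lemma \<open>ascendant_seriesD\<close> below shows that this is no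
  restriction: a series over any well-order on any type can be reindexed by its own members.
\<close>

definition ascendant :: "'a set \<Rightarrow> ('a, 'b) monoid_scheme \<Rightarrow> bool" where
  "ascendant H E \<longleftrightarrow>
     (\<exists>(r :: 'a set rel) \<gamma> (Hs :: 'a set \<Rightarrow> 'a set). ascendant_series r \<gamma> Hs H E)"

lemma ascendant_seriesD:
  fixes r :: "'i rel" and E :: "('a, 'b) monoid_scheme"
  assumes "ascendant_series r \<gamma> Hs H E"
  shows "ascendant H E"
proof -
  let ?F = "Field r"
  have wo: "Well_order r" and g: "\<gamma> \<in> ?F" and gmax: "\<And>\<alpha>. \<alpha> \<in> ?F \<Longrightarrow> (\<alpha>, \<gamma>) \<in> r"
    and sub: "\<And>\<alpha>. \<alpha> \<in> ?F \<Longrightarrow> subgroup (Hs \<alpha>) E"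
    and H0: "Hs (wo_rel.minim r ?F) = H" and Hg: "Hs \<gamma> = carrier E"
    and Hsuc: "\<And>\<alpha>. \<alpha> \<in> underS r \<gamma> \<Longrightarrow> Hs \<alpha> \<lhd> E\<lparr>carrier := Hs (wo_rel.suc r {\<alpha>})\<rparr>"
    and Hlim: "\<And>l. limit_elem r l \<Longrightarrow> Hs l = (\<Union>\<alpha> \<in> underS r l. Hs \<alpha>)"
    using assms unfolding ascendant_series_def by auto
  interpret r: wo_rel r by standard (rule wo)
  have fld: "a \<in> ?F" "b \<in> ?F" if "(a, b) \<in> r" for a b
    using that by (auto simp: Field_def)
  have sucp: "(a, r.suc {a}) \<in> r" "r.suc {a} \<noteq> a" "(r.suc {a}, b) \<in> r"
    if "a \<in> underS r b" for a b
  proof -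
    have b: "b \<in> AboveS r {a}" using that fld by (auto simp: underS_def AboveS_def)
    then show "(r.suc {a}, b) \<in> r" by (rule r.suc_least_AboveS)
    show "(a, r.suc {a}) \<in> r" "r.suc {a} \<noteq> a"
      using r.suc_greater[of "{a}" a] b that fld by (auto simp: underS_def)
  qed
  have lt_g: "a \<in> underS r \<gamma>" if "a \<in> underS r b" for a b
    using that gmax[OF fld(1)] gmax[OF fld(2)] r.ANTISYM
    by (auto simp: underS_def antisym_def)
  have step: "Hs a \<subseteq> Hs (r.suc {a})" if "a \<in> underS r b" for a b
    using normal_imp_subgroup[OF Hsuc[OF lt_g[OF that]], THEN subgroup.subset] by simp
  have nlt: "(b, a) \<in> r" if "a \<in> ?F" "b \<in> ?F" "a \<notin> underS r b" for a b
    using that r.in_notinI[of a b] by (auto simp: underS_def)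
  have mono: "(a, b) \<in> r \<Longrightarrow> Hs a \<subseteq> Hs b" for a b
  proof (induction b rule: r.well_order_induct)
    case (1 b)
    show ?case
    proof (cases "a = b")
      case False
      then have ab: "a \<in> underS r b" using 1 by (auto simp: underS_def)
      show ?thesis
      proof (cases "limit_elem r b")
        case True
        then show ?thesis using Hlim ab by auto
      next
        case False
        then obtain d where d: "d \<in> underS r b" "r.suc {d} = b"
          using ab fld 1(2) by (auto simp: limit_elem_def)
        have "(a, d) \<in> r"
        proof (rule nlt)
          show "d \<in> ?F" "a \<in> ?F" using d ab fld by (auto simp: underS_def)
          show "d \<notin> underS r a"
          proof
            assume "d \<in> underS r a"
            then have "(b, a) \<in> r" using sucp(3) d by auto
            then show False using ab r.ANTISYM by (auto simp: underS_def antisym_def)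
          qed
        qed
        then have "Hs a \<subseteq> Hs d" using 1(1) d by (auto simp: underS_def)
        then show ?thesis using step[OF d(1)] d(2) by auto
      qed
    qed auto
  qed
  have lt_if: "a \<in> underS r b" if "a \<in> ?F" "b \<in> ?F" "Hs a \<subset> Hs b" for a b
    using nlt[of a b] that mono[of b a] by auto
  define q where "q = {(A, B). A \<in> Hs ` ?F \<and> B \<in> Hs ` ?F \<and> A \<subseteq> B}"
  have Fq: "Field q = Hs ` ?F" by (auto simp: q_def Field_def)
  have tot: "Hs a \<subseteq> Hs b \<or> Hs b \<subseteq> Hs a" if "a \<in> ?F" "b \<in> ?F" for a b
    using r.TOTALS that mono by blast
  have lin: "Linear_order q"
    unfolding order_on_defs
  proof (intro conjI)
    show "q \<subseteq> Field q \<times> Field q" unfolding Fq by (auto simp: q_def)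
    show "Refl q" unfolding Fq by (auto simp: q_def refl_on_def)
    show "trans q" by (auto simp: q_def trans_def)
    show "antisym q" by (auto simp: q_def antisym_def)
    show "Total q" unfolding Fq total_on_def using tot by (auto simp: q_def)
  qed
  have "\<exists>A \<in> S. \<forall>B \<in> S. (A, B) \<in> q" if S: "S \<subseteq> Field q" "S \<noteq> {}" for S
  proof -
    let ?I = "{a \<in> ?F. Hs a \<in> S}"
    have I: "?I \<subseteq> ?F" "?I \<noteq> {}" using S unfolding Fq by auto
    have "(Hs (r.minim ?I), B) \<in> q" if B: "B \<in> S" for B
    proof -
      obtain b where b: "b \<in> ?I" "B = Hs b" using B S(1) unfolding Fq by blast
      show ?thesis using r.minim_in[OF I] r.minim_least[OF I(1) b(1)] b mono
        by (auto simp: q_def)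
    qed
    then show ?thesis using r.minim_in[OF I] by auto
  qed
  then have woq: "Well_order q"
    using Linear_order_Well_order_iff[OF lin] by auto
  interpret q: wo_rel q by standard (rule woq)
  have uq: "A \<in> underS q B \<longleftrightarrow> A \<in> Hs ` ?F \<and> B \<in> Hs ` ?F \<and> A \<subset> B" for A B
    by (auto simp: underS_def q_def)
  have sucq: "q.suc {Hs d} = Hs (r.suc {d})"
    if d: "d \<in> underS r b" and lt: "Hs d \<subset> Hs (r.suc {d})" for d b
  proof (rule q.equals_suc_AboveS[symmetric])
    have dF: "d \<in> ?F" "r.suc {d} \<in> ?F" using sucp(1)[OF d] fld by auto
    then show "{Hs d} \<subseteq> Field q" by (auto simp: Fq)
    show "Hs (r.suc {d}) \<in> AboveS q {Hs d}"
      using dF lt Fq by (auto simp: AboveS_def q_def)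
    fix A assume A: "A \<in> AboveS q {Hs d}"
    then obtain a where a: "a \<in> ?F" "A = Hs a" "Hs d \<subset> Hs a"
      unfolding AboveS_def Fq by (auto simp: q_def)
    have "(r.suc {d}, a) \<in> r" using sucp(3)[OF lt_if[OF dF(1) a(1) a(3)]] .
    then show "(Hs (r.suc {d}), A) \<in> q" using mono dF a by (auto simp: q_def)
  qed
  have "ascendant_series q (carrier E) id H E"
    unfolding ascendant_series_def id_apply
  proof (intro conjI ballI allI impI)
    show "Well_order q" by (rule woq)
    show "carrier E \<in> Field q" using g Hg Fq by auto
    show "(A, carrier E) \<in> q" if "A \<in> Field q" for A
    proof -
      obtain a where a: "a \<in> ?F" "A = Hs a" using \<open>A \<in> Field q\<close> unfolding Fq by blast
      then show ?thesis using mono[OF gmax[OF a(1)]] g Hg[symmetric] by (simp add: q_def)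
    qed
    show "subgroup A E" if "A \<in> Field q" for A using that sub Fq by auto
    have mF: "r.minim ?F \<in> ?F" by (rule r.minim_in) (use g in auto)
    have "H = q.minim (Field q)"
    proof (rule q.equals_minim)
      show "H \<in> Field q" using mF H0 Fq by auto
      show "(H, B) \<in> q" if "B \<in> Field q" for B
      proof -
        obtain b where b: "b \<in> ?F" "B = Hs b" using \<open>B \<in> Field q\<close> unfolding Fq by blast
        then show ?thesis using mono[OF r.minim_least[OF subset_refl b(1)]] mF H0[symmetric]
          by (simp add: q_def)
      qed
    qed simp
    then show "q.minim (Field q) = H" by simp
    show "carrier E = carrier E" ..
    show "A \<lhd> E\<lparr>carrier := q.suc {A}\<rparr>" if A: "A \<in> underS q (carrier E)" for A
    proof -
      obtain a where a: "a \<in> ?F" "A = Hs a" "Hs a \<subset> Hs \<gamma>" using A uq Hg by auto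
      let ?B = "{b \<in> ?F. Hs a \<subset> Hs b}"
      have B: "?B \<subseteq> ?F" "?B \<noteq> {}" using a g by auto
      define b where "b = r.minim ?B"
      have b: "b \<in> ?F" "Hs a \<subset> Hs b" using r.minim_in[OF B] by (auto simp: b_def)
      have ab: "a \<in> underS r b" using lt_if a b by auto
      have below: "Hs c \<subseteq> Hs a" if "c \<in> underS r b" for c
      proof (rule ccontr)
        assume n: "\<not> Hs c \<subseteq> Hs a"
        have cF: "c \<in> ?F" using that fld by (auto simp: underS_def)
        then have "c \<in> ?B" using n tot[of c a] a by auto
        then have "(b, c) \<in> r" unfolding b_def using r.minim_least[OF B(1)] by auto
        then show False using that r.ANTISYM by (auto simp: underS_def antisym_def)
      qed
      have "\<not> limit_elem r b" using Hlim[of b] below b(2) by blast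
      then obtain d where d: "d \<in> underS r b" "r.suc {d} = b"
        using ab b by (auto simp: limit_elem_def)
      have dF: "d \<in> ?F" using d fld by (auto simp: underS_def)
      have "d \<notin> underS r a"
        using sucp(3)[of d a] d(2) ab r.ANTISYM by (auto simp: underS_def antisym_def)
      then have "Hs a \<subseteq> Hs d" using mono nlt[OF dF a(1)] by auto
      then have eq: "Hs d = Hs a" using below[OF d(1)] by auto
      then show ?thesis
        using sucq[OF d(1)] Hsuc[OF lt_g[OF d(1)]] d(2) b(2) a(2) by auto
    qed
    show "K = (\<Union>A \<in> underS q K. A)" if K: "limit_elem q K" for K
    proof -
      let ?A = "{a \<in> ?F. Hs a = K}"
      have A: "?A \<subseteq> ?F" "?A \<noteq> {}" using K Fq by (auto simp: limit_elem_def)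
      define a where "a = r.minim ?A"
      have a: "a \<in> ?F" "Hs a = K" using r.minim_in[OF A] by (auto simp: a_def)
      have strict: "Hs c \<subset> K" if "c \<in> underS r a" for c
      proof -
        have "Hs c \<noteq> K"
        proof
          assume "Hs c = K"
          then have "c \<in> ?A" using that fld by (auto simp: underS_def)
          then have "(a, c) \<in> r" unfolding a_def using r.minim_least[OF A(1)] by auto
          then show False using that r.ANTISYM by (auto simp: underS_def antisym_def)
        qed
        then show ?thesis using mono[of c a] that a by (auto simp: underS_def)
      qed
      have "underS r a \<noteq> {}"
      proof -
        obtain C where "C \<in> underS q K" using K by (auto simp: limit_elem_def)
        then obtain c where "c \<in> ?F" "Hs c \<subset> Hs a" using uq a by auto
        then show ?thesis using lt_if a by blast
      qed
      moreover have "r.suc {d} \<noteq> a" if "d \<in> underS r a" for d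
      proof
        assume e: "r.suc {d} = a"
        have "q.suc {Hs d} = K" using sucq[OF that] strict[OF that] e a by auto
        moreover have "Hs d \<in> underS q K"
          using strict[OF that] that fld a uq by (auto simp: underS_def)
        ultimately show False using K by (auto simp: limit_elem_def)
      qed
      ultimately have "limit_elem r a" using a by (auto simp: limit_elem_def)
      then have K_eq: "K = (\<Union>c \<in> underS r a. Hs c)" using Hlim a by auto
      have "Hs c \<in> underS q K" if "c \<in> underS r a" for c
        using strict[OF that] that fld a uq by (auto simp: underS_def)
      then have "K \<subseteq> (\<Union>A \<in> underS q K. A)" using K_eq by blast
      then show ?thesis using uq by blast
    qed
  qed
  then show ?thesis unfolding ascendant_def by blast
qed

end

theory Submission
  imports Defs "HOL-Number_Theory.Residues"
begin

text \<open>
  Every element of \<open>G\<close> is torsion and the characteristic is positive. If \<open>a \<in> G\<close> is not central, it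
  generates a finite field \<open>K\<close>, and conjugation by \<open>a\<close> is diagonalizable over \<open>K\<close>; an eigenvector
  gives \<open>y \<noteq> 0\<close> with \<open>y a y\<^sup>-\<^sup>1 = a\<^sup>i \<noteq> a\<close>. By Wedderburn's theorem the ring \<open>K[y]\<close> is infinite, so
  it is a skew polynomial ring and one can speak of congruences modulo powers of \<open>y\<close>. Starting from
  \<open>b = 1 + y\<close>, the iterated commutators \<open>[a, [a, \<dots> [a, b]]]\<close> are congruent to \<open>1 + c\<^sup>n y\<close> modulo \<open>y\<^sup>2\<close>
  with \<open>c \<noteq> 0\<close>, hence are not torsion. But descending along the ascendant series they eventually
  fall into \<open>G\<close>.
\<close>

section \<open>Division rings\<close>

text \<open>Positive characteristic \<open>p\<close> obstructs twice: splitting an element into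
  eigenvectors of conjugation by \<open>a\<close> divides by the order of \<open>a\<close>, and a
  \<open>k\<close>-th power multiplies the coefficient of \<open>y\<close> by \<open>k\<close>,
  which is zero when \<open>p\<close> divides \<open>k\<close>. One remedy serves both: a torsion
  element lies in a finite division ring with \<open>q\<close> elements, and its exponent
  \<open>q - 1\<close> equals -1 in that ring. Hence the recurring hypothesis that a certain
  multiple of one is nonzero. The coefficient \<open>c\<close> is \<open>e - 1\<close>, where
  \<open>e = a^(1-i)\<close> is the factor by which conjugation by \<open>a\<close> scales
  \<open>y\<close>; it is nonzero exactly because \<open>a^i\<close> differs from \<open>a\<close>.
  The eigenvector argument also works inside the proof of Wedderburn's theorem, where it supplies
  the element that normalizes a minimal noncentral one.\<close>

context skew_field
begin

lemma Units_iff: "x \<in> Units R \<longleftrightarrow> x \<in> carrier R \<and> x \<noteq> \<zero>"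
  using skew_field_Units by auto

lemma inv_nonzero [simp]:
  assumes "x \<in> carrier R" "x \<noteq> \<zero>"
  shows "inv x \<in> carrier R" "inv x \<noteq> \<zero>" "inv x \<otimes> x = \<one>" "x \<otimes> inv x = \<one>"
  using assms Units_inv_Units[of x] Units_l_inv[of x] Units_r_inv[of x] by (auto simp: Units_iff)

lemma mult_left_cancel:
  assumes "x \<in> carrier R" "x \<noteq> \<zero>" "y \<in> carrier R" "z \<in> carrier R"
  shows "x \<otimes> y = x \<otimes> z \<longleftrightarrow> y = z"
  using assms Units_l_cancel Units_iff by blast

lemma mult_right_cancel:
  assumes "x \<in> carrier R" "x \<noteq> \<zero>" "y \<in> carrier R" "z \<in> carrier R"
  shows "y \<otimes> x = z \<otimes> x \<longleftrightarrow> y = z"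
proof
  assume "y \<otimes> x = z \<otimes> x"
  then have "y \<otimes> x \<otimes> inv x = z \<otimes> x \<otimes> inv x" by (rule arg_cong)
  then have "y \<otimes> (x \<otimes> inv x) = z \<otimes> (x \<otimes> inv x)"
    using assms by (simp add: m_assoc del: inv_nonzero(3,4))
  then show "y = z" using assms by simp
qed simp

lemma mult_nonzero:
  assumes "x \<in> carrier R" "x \<noteq> \<zero>" "y \<in> carrier R" "y \<noteq> \<zero>"
  shows "x \<otimes> y \<noteq> \<zero>"
  using assms mult_left_cancel[of x y \<zero>] by simp

lemma integral:
  assumes "x \<otimes> y = \<zero>" "x \<in> carrier R" "y \<in> carrier R"
  shows "x = \<zero> \<or> y = \<zero>"
  using assms mult_nonzero by blast

lemma pow_nonzero:
  "x \<in> carrier R \<Longrightarrow> x \<noteq> \<zero> \<Longrightarrow> x [^] (n::nat) \<noteq> \<zero>"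
  by (induction n) (auto simp: one_not_zero mult_nonzero)

lemma pow_eq_one_nonzero:
  assumes "x \<in> carrier R" "x [^] (n::nat) = \<one>" "n > 0"
  shows "x \<noteq> \<zero>"
  using assms nat_pow_zero[of n] one_not_zero by auto

lemma inv_pow_eq:
  assumes "a \<in> carrier R" "a \<noteq> \<zero>"
  shows "inv a [^] (i::nat) \<otimes> a [^] i = \<one>" "a [^] i \<otimes> inv a [^] i = \<one>"
  using pow_mult_distrib[of "inv a" a i, symmetric] pow_mult_distrib[of a "inv a" i, symmetric] assms
  by simp_all

lemma commute_inv:
  assumes "x \<in> carrier R" "x \<noteq> \<zero>" "y \<in> carrier R" "x \<otimes> y = y \<otimes> x"
  shows "inv x \<otimes> y = y \<otimes> inv x"
proof -
  have "inv x \<otimes> (y \<otimes> x) \<otimes> inv x = inv x \<otimes> (x \<otimes> y) \<otimes> inv x" using assms by simp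
  then have "(inv x \<otimes> y) \<otimes> (x \<otimes> inv x) = (inv x \<otimes> x) \<otimes> (y \<otimes> inv x)"
    using assms(1-3) by (simp add: m_assoc del: inv_nonzero(3,4))
  then show ?thesis using assms by simp
qed

lemma subring_skew_field:
  assumes S: "subring S R" and inv: "\<And>x. x \<in> S \<Longrightarrow> x \<noteq> \<zero> \<Longrightarrow> inv x \<in> S"
  shows "skew_field (R\<lparr>carrier := S\<rparr>)"
proof -
  interpret S: ring "R\<lparr>carrier := S\<rparr>" by (rule subring_is_ring[OF S])
  have sub: "S \<subseteq> carrier R" using subringE(1)[OF S] .
  have "Units (R\<lparr>carrier := S\<rparr>) = S - {\<zero>}"
  proof
    show "Units (R\<lparr>carrier := S\<rparr>) \<subseteq> S - {\<zero>}"
      using sub one_not_zero by (auto simp: Units_def)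
    show "S - {\<zero>} \<subseteq> Units (R\<lparr>carrier := S\<rparr>)"
    proof
      fix x assume "x \<in> S - {\<zero>}"
      then show "x \<in> Units (R\<lparr>carrier := S\<rparr>)"
        using sub inv[of x] by (auto simp: Units_def intro!: bexI[of _ "inv x"])
    qed
  qed
  then show ?thesis
    by unfold_locales (auto simp: one_not_zero)
qed

text \<open>Left multiplication by \<open>x\<close> is injective on the finite set \<open>S\<close>,
  hence surjective, so it attains one.\<close>

lemma finite_subring_inv:
  assumes S: "subring S R" "finite S" and x: "x \<in> S" "x \<noteq> \<zero>"
  shows "inv x \<in> S"
proof -
  have sub: "S \<subseteq> carrier R" using subringE(1)[OF S(1)] .
  have "inj_on ((\<otimes>) x) S"
    using x sub mult_left_cancel[of x] by (auto simp: inj_on_def subset_eq)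
  moreover have "(\<otimes>) x ` S \<subseteq> S" using subringE(6)[OF S(1)] x by auto
  ultimately have "(\<otimes>) x ` S = S" using endo_inj_surj[OF S(2)] by blast
  then obtain w where w: "w \<in> S" "x \<otimes> w = \<one>"
    using subringE(3)[OF S(1)] by (metis imageE)
  then have "x \<otimes> w = x \<otimes> inv x" using x sub by auto
  then have "w = inv x" 
    using mult_left_cancel[of x w "inv x"] x w(1) sub by (simp add: subset_eq)
  then show ?thesis using w by simp
qed

lemma finite_subring_skew_field:
  assumes "subring S R" "finite S"
  shows "skew_field (R\<lparr>carrier := S\<rparr>)"
  using subring_skew_field finite_subring_inv assms by blast

text \<open>Lagrange's theorem in the group of units and in the additive group. The exponent
  \<open>card (carrier R) - 1\<close> kills all units and still equals -1, hence is nonzero, in the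
  ring.\<close>

lemma pow_card_eq_one:
  assumes fin: "finite (carrier R)" and a: "a \<in> carrier R" "a \<noteq> \<zero>"
  shows "a [^] (card (carrier R) - 1) = \<one>" "add_pow R (card (carrier R) - 1) \<one> = \<ominus> \<one>"
    "card (carrier R) - 1 > 0"
proof -
  interpret U: group "units_of R" by (rule units_group)
  have "order (units_of R) = card (carrier R) - 1"
    using fin by (simp add: order_def units_of_carrier skew_field_Units)
  then show "a [^] (card (carrier R) - 1) = \<one>"
    using U.pow_order_eq_1[of a] a
    by (simp add: units_of_carrier Units_iff units_of_pow units_of_one)
  have "card {\<zero>, \<one>} \<le> card (carrier R)" by (rule card_mono) (use fin in auto)
  then show pos: "card (carrier R) - 1 > 0" using one_not_zero by simp
  have "add_pow R (card (carrier R)) \<one> = \<zero>"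
    using add.pow_order_eq_1[of \<one>] by (simp add: order_def)
  moreover obtain m where m: "card (carrier R) = Suc m" using pos by (cases "card (carrier R)") auto
  ultimately have "add_pow R m \<one> \<oplus> \<one> = \<zero>" by simp
  then have "add_pow R m \<one> = \<ominus> \<one>" by (intro minus_equality[symmetric]) auto
  then show "add_pow R (card (carrier R) - 1) \<one> = \<ominus> \<one>" using m by simp
qed

end

section \<open>Skew polynomials inside a division ring\<close>

text \<open>Values \<open>c_0 + c_1 y + ... + c_(k-1) y^(k-1)\<close> in Horner form, with
  coefficients on the left. They are elements of the given ring rather than formal expressions, so
  uniqueness of coefficients has to be proved where it holds.\<close>

primrec skew_polys :: "('a, 'b) ring_scheme \<Rightarrow> 'a set \<Rightarrow> 'a \<Rightarrow> nat \<Rightarrow> 'a set" where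
  "skew_polys R B y 0 = {\<zero>\<^bsub>R\<^esub>}"
| "skew_polys R B y (Suc k) =
     (\<lambda>(c, g). c \<oplus>\<^bsub>R\<^esub> g \<otimes>\<^bsub>R\<^esub> y) ` (B \<times> skew_polys R B y k)"

definition skew_poly_ring :: "('a, 'b) ring_scheme \<Rightarrow> 'a set \<Rightarrow> 'a \<Rightarrow> 'a set" where
  "skew_poly_ring R B y = (\<Union>k. skew_polys R B y k)"

lemma skew_polys_Suc_iff:
  "x \<in> skew_polys R B y (Suc k) \<longleftrightarrow>
     (\<exists>c\<in>B. \<exists>g\<in>skew_polys R B y k. x = c \<oplus>\<^bsub>R\<^esub> g \<otimes>\<^bsub>R\<^esub> y)"
  by auto

lemma skew_poly_ring_zero: "\<zero>\<^bsub>R\<^esub> \<in> skew_poly_ring R B y"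
  unfolding skew_poly_ring_def by (rule UN_I[of 0]) auto

lemma skew_poly_ring_step:
  assumes "c \<in> B" "g \<in> skew_poly_ring R B y"
  shows "c \<oplus>\<^bsub>R\<^esub> g \<otimes>\<^bsub>R\<^esub> y \<in> skew_poly_ring R B y"
proof -
  obtain k where "g \<in> skew_polys R B y k" using assms by (auto simp: skew_poly_ring_def)
  then have "c \<oplus>\<^bsub>R\<^esub> g \<otimes>\<^bsub>R\<^esub> y \<in> skew_polys R B y (Suc k)" using assms by auto
  then show ?thesis unfolding skew_poly_ring_def by blast
qed

lemma skew_poly_ring_induct [consumes 1, case_names zero step]:
  assumes "x \<in> skew_poly_ring R B y"
    and "P \<zero>\<^bsub>R\<^esub>"
    and "\<And>c g. c \<in> B \<Longrightarrow> g \<in> skew_poly_ring R B y \<Longrightarrow> P g \<Longrightarrow> P (c \<oplus>\<^bsub>R\<^esub> g \<otimes>\<^bsub>R\<^esub> y)"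
  shows "P x"
proof -
  have "\<forall>x \<in> skew_polys R B y k. P x" for k
  proof (induction k)
    case (Suc k)
    then show ?case using assms(3) by (fastforce simp: skew_poly_ring_def)
  qed (use assms(2) in simp)
  then show ?thesis using assms(1) by (auto simp: skew_poly_ring_def)
qed

lemma finite_skew_polys: "finite B \<Longrightarrow> finite (skew_polys R B y k)"
  by (induction k) auto

text \<open>\<open>twist\<close> lets \<open>y\<close> move to the right past a coefficient, which
  is what closes the left polynomials in \<open>y\<close> under multiplication.\<close>

locale skew_extension = skew_field +
  fixes B y
  assumes B: "subring B R"
    and y: "y \<in> carrier R" "y \<noteq> \<zero>"
    and twist: "c \<in> B \<Longrightarrow> \<exists>c'\<in>B. y \<otimes> c = c' \<otimes> y"
begin

abbreviation "S \<equiv> skew_poly_ring R B y"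
abbreviation "L \<equiv> skew_polys R B y"

lemma B_carrier: "c \<in> B \<Longrightarrow> c \<in> carrier R"
  using subringE(1)[OF B] by auto

lemma L_carrier: "x \<in> L k \<Longrightarrow> x \<in> carrier R"
  by (induction k arbitrary: x) (auto simp: y B_carrier)

lemma S_carrier: "x \<in> S \<Longrightarrow> x \<in> carrier R"
  unfolding skew_poly_ring_def using L_carrier by auto

lemma L_Suc_mono: "x \<in> L k \<Longrightarrow> x \<in> L (Suc k)"
proof (induction k arbitrary: x)
  case 0
  then show ?case using subringE(2)[OF B] y by (force simp: skew_polys_Suc_iff)
next
  case (Suc k)
  then show ?case by (subst skew_polys_Suc_iff) (auto simp del: skew_polys.simps(2) simp: skew_polys_Suc_iff[of x])
qed

lemma L_mono:
  assumes "x \<in> L k" "k \<le> l"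
  shows "x \<in> L l"
  using assms(2)
proof (induction rule: dec_induct)
  case base
  show ?case by (rule assms(1))
qed (rule L_Suc_mono)

lemma L_add: "f \<in> L k \<Longrightarrow> g \<in> L k \<Longrightarrow> f \<oplus> g \<in> L k"
proof (induction k arbitrary: f g)
  case (Suc k)
  obtain c h d j where *: "c \<in> B" "h \<in> L k" "f = c \<oplus> h \<otimes> y" "d \<in> B" "j \<in> L k" "g = d \<oplus> j \<otimes> y"
    using Suc.prems by auto
  then have "c \<in> carrier R" "d \<in> carrier R" "h \<in> carrier R" "j \<in> carrier R"
    using B_carrier L_carrier by auto
  then have "f \<oplus> g = (c \<oplus> d) \<oplus> (h \<oplus> j) \<otimes> y"
    unfolding * using y by (simp add: l_distr a_ac)
  then show ?case using Suc.IH[of h j] * subringE(7)[OF B] by (force simp: skew_polys_Suc_iff)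
qed simp

lemma L_scale: "c \<in> B \<Longrightarrow> f \<in> L k \<Longrightarrow> c \<otimes> f \<in> L k"
proof (induction k arbitrary: f)
  case (Suc k)
  obtain d h where *: "d \<in> B" "h \<in> L k" "f = d \<oplus> h \<otimes> y"
    using Suc.prems by auto
  then have "d \<in> carrier R" "h \<in> carrier R" "c \<in> carrier R"
    using B_carrier L_carrier Suc.prems by auto
  then have "c \<otimes> f = (c \<otimes> d) \<oplus> (c \<otimes> h) \<otimes> y"
    unfolding * using y by (simp add: r_distr m_assoc)
  then show ?case using Suc.IH[of h] Suc.prems * subringE(6)[OF B] by (force simp: skew_polys_Suc_iff)
qed (auto simp: B_carrier)

lemma S_add: "f \<in> S \<Longrightarrow> g \<in> S \<Longrightarrow> f \<oplus> g \<in> S"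
proof -
  assume "f \<in> S" "g \<in> S"
  then obtain k l where "f \<in> L k" "g \<in> L l" by (auto simp: skew_poly_ring_def)
  then have "f \<in> L (max k l)" "g \<in> L (max k l)" using L_mono by auto
  then show ?thesis using L_add unfolding skew_poly_ring_def by blast
qed

lemma S_scale: "c \<in> B \<Longrightarrow> f \<in> S \<Longrightarrow> c \<otimes> f \<in> S"
  using L_scale unfolding skew_poly_ring_def by blast

lemma base_in_S: "c \<in> B \<Longrightarrow> c \<in> S"
  using skew_poly_ring_step[OF _ skew_poly_ring_zero, of c B R y] y by (simp add: B_carrier)

lemma S_mult_y: "f \<in> S \<Longrightarrow> f \<otimes> y \<in> S"
  using skew_poly_ring_step[of \<zero> B f R y] subringE(2)[OF B] y S_carrier[of f] by simp

lemma y_in_S: "y \<in> S"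
  using S_mult_y[OF base_in_S[OF subringE(3)[OF B]]] y by simp

lemma y_mult_S: "f \<in> S \<Longrightarrow> y \<otimes> f \<in> S"
proof (induction f rule: skew_poly_ring_induct)
  case zero
  then show ?case using y skew_poly_ring_zero by simp
next
  case (step c g)
  obtain c' where c': "c' \<in> B" "y \<otimes> c = c' \<otimes> y" using twist step by blast
  have "y \<otimes> (c \<oplus> g \<otimes> y) = c' \<otimes> y \<oplus> (y \<otimes> g) \<otimes> y"
    using step c' y S_carrier[of g] B_carrier by (simp add: r_distr m_assoc)
  also have "\<dots> = (c' \<oplus> y \<otimes> g) \<otimes> y"
    using step c' y S_carrier[of g] B_carrier by (simp add: l_distr)
  finally show ?case using step c' by (simp add: S_mult_y S_add base_in_S)
qed

lemma S_mult: "f \<in> S \<Longrightarrow> h \<in> S \<Longrightarrow> f \<otimes> h \<in> S"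
proof (induction f arbitrary: h rule: skew_poly_ring_induct)
  case zero
  then show ?case using S_carrier skew_poly_ring_zero by simp
next
  case (step c g)
  have "(c \<oplus> g \<otimes> y) \<otimes> h = c \<otimes> h \<oplus> g \<otimes> (y \<otimes> h)"
    using step y S_carrier B_carrier by (simp add: l_distr m_assoc)
  then show ?case using step by (simp add: S_add S_scale y_mult_S)
qed

lemma S_subring: "subring S R"
proof (rule subringI)
  have m: "\<ominus> \<one> \<in> B" using subringE(3,5)[OF B] by blast
  show "\<ominus> f \<in> S" if "f \<in> S" for f
    using S_scale[OF m that] S_carrier[OF that] by (simp add: l_minus)
qed (use S_add S_mult S_carrier base_in_S subringE(3)[OF B] in auto)

text \<open>Right multiplication by \<open>inv y\<close> lowers exponents and turns a constant
  \<open>c\<close> into \<open>c (inv y)\<close>, so it maps the finite set \<open>L k\<close>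
  containing \<open>inv y\<close> injectively into itself. It is therefore onto, \<open>L k\<close>
  is closed under right multiplication by \<open>y\<close>, and \<open>S\<close> is contained in
  \<open>L k\<close>.\<close>

lemma finite_S:
  assumes fin: "finite B" and inv: "inv y \<in> S"
  shows "finite S"
proof -
  obtain k where k: "inv y \<in> L k" using inv by (auto simp: skew_poly_ring_def)
  then obtain m where m: "k = Suc m" using y by (cases k) auto
  have "f \<otimes> inv y \<in> L k" if f: "f \<in> L k" for f
  proof -
    obtain c g where *: "c \<in> B" "g \<in> L m" "f = c \<oplus> g \<otimes> y"
      using f unfolding m skew_polys_Suc_iff by blast
    then have "f \<otimes> inv y = c \<otimes> inv y \<oplus> g"
      using y L_carrier[of g] B_carrier by (simp add: l_distr m_assoc)
    moreover have "c \<otimes> inv y \<in> L k" using * k L_scale by blast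
    moreover have "g \<in> L k" unfolding m using * L_Suc_mono by blast
    ultimately show ?thesis using L_add by simp
  qed
  then have "(\<lambda>f. f \<otimes> inv y) ` L k \<subseteq> L k" by blast
  moreover have "inj_on (\<lambda>f. f \<otimes> inv y) (L k)"
    using mult_right_cancel[of "inv y"] y L_carrier by (simp add: inj_on_def)
  ultimately have surj: "(\<lambda>f. f \<otimes> inv y) ` L k = L k"
    by (intro endo_inj_surj finite_skew_polys[OF fin])
  have right: "f \<otimes> y \<in> L k" if f: "f \<in> L k" for f
  proof -
    obtain g where "g \<in> L k" "f = g \<otimes> inv y" using f surj by blast
    then show ?thesis using y L_carrier[of g] by (simp add: m_assoc)
  qed
  have base: "c \<in> L k" if "c \<in> B" for c
  proof -
    have "c \<oplus> \<zero> \<otimes> y \<in> L (Suc 0)" using that by auto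
    then show ?thesis using L_mono[of c "Suc 0" k] m that y B_carrier by simp
  qed
  have "f \<in> L k" if "f \<in> S" for f
    using that
  proof (induction f rule: skew_poly_ring_induct)
    case zero
    show ?case by (rule L_mono[of _ 0]) auto
  next
    case (step c g)
    then show ?case using base right L_add by blast
  qed
  then show ?thesis by (intro finite_subset[OF _ finite_skew_polys[OF fin]] subsetI)
qed

end

context skew_field
begin

lemma prime_subring:
  fixes N :: nat
  assumes N: "N > 0" "add_pow R N \<one> = \<zero>"
  shows "subring (range (\<lambda>i::nat. add_pow R i \<one>)) R" "finite (range (\<lambda>i::nat. add_pow R i \<one>))"
proof -
  let ?e = "\<lambda>i::nat. add_pow R i \<one>"
  have mult: "?e i \<otimes> ?e j = ?e (i * j)" for i j
    by (simp add: add_pow_ldistr add.nat_pow_pow mult.commute)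
  have "?e (i mod N) = ?e i" for i
  proof -
    have "?e (N * (i div N)) = \<zero>"
      using N add.nat_pow_pow[of \<one> "i div N" N] by simp
    then have "?e (N * (i div N)) \<oplus> ?e (i mod N) = ?e (i mod N)" by simp
    then show ?thesis by (simp add: add.nat_pow_mult)
  qed
  then have "range ?e \<subseteq> ?e ` {..<N}" using N by (metis image_subsetI imageI lessThan_iff mod_less_divisor)
  then show "finite (range ?e)" by (rule finite_subset) simp
  show "subring (range ?e) R"
  proof (rule subringI)
    show "\<one> \<in> range ?e" by (rule range_eqI[of _ _ 1]) simp
    fix h h' assume "h \<in> range ?e" "h' \<in> range ?e"
    then obtain i j where ij: "h = ?e i" "h' = ?e j" by blast
    show "h \<otimes> h' \<in> range ?e" "h \<oplus> h' \<in> range ?e"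
      unfolding ij mult by (auto simp: add.nat_pow_mult)
    have "?e ((N - 1) * i) \<oplus> ?e i = ?e (N * i)"
      using N by (simp add: add.nat_pow_mult algebra_simps)
    also have "\<dots> = \<zero>" using N by (simp flip: add.nat_pow_pow)
    finally have "\<ominus> h = ?e ((N - 1) * i)" unfolding ij by (rule minus_equality) auto
    then show "\<ominus> h \<in> range ?e" by simp
  qed auto
qed

end

section \<open>Eigenvectors of conjugation\<close>

lemma (in abelian_monoid) finsum_swap:
  assumes "finite A" "finite B" "\<And>i j. i \<in> A \<Longrightarrow> j \<in> B \<Longrightarrow> f i j \<in> carrier G"
  shows "(\<Oplus>i\<in>A. \<Oplus>j\<in>B. f i j) = (\<Oplus>j\<in>B. \<Oplus>i\<in>A. f i j)"
  using assms(1,3)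
proof (induction A rule: finite_induct)
  case empty
  then show ?case by (simp add: finsum_zero)
next
  case (insert k A)
  have c: "(\<lambda>j. f k j) \<in> B \<rightarrow> carrier G" "(\<lambda>j. \<Oplus>i\<in>A. f i j) \<in> B \<rightarrow> carrier G"
    "(\<lambda>i. \<Oplus>j\<in>B. f i j) \<in> A \<rightarrow> carrier G" "(\<Oplus>j\<in>B. f k j) \<in> carrier G"
    using insert.prems by (auto intro!: finsum_closed)
  have "(\<Oplus>j\<in>B. \<Oplus>i\<in>insert k A. f i j) = (\<Oplus>j\<in>B. f k j \<oplus> (\<Oplus>i\<in>A. f i j))"
    using insert by (intro finsum_cong') (auto intro!: finsum_closed)
  also have "\<dots> = (\<Oplus>j\<in>B. f k j) \<oplus> (\<Oplus>j\<in>B. \<Oplus>i\<in>A. f i j)"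
    by (rule finsum_addf[OF c(1,2)])
  also have "\<dots> = (\<Oplus>i\<in>insert k A. \<Oplus>j\<in>B. f i j)"
    using insert c by simp
  finally show ?case ..
qed

lemma (in abelian_group) finsum_cyclic_shift:
  fixes f :: "nat \<Rightarrow> 'a"
  assumes f: "\<And>i. f i \<in> carrier G" and "f n = f 0"
  shows "(\<Oplus>i\<in>{..<n}. f (Suc i)) = (\<Oplus>i\<in>{..<n}. f i)"
proof -
  \<comment> \<open>With both end terms kept, the identity holds for every \<open>n\<close> without
    periodicity, so it can be proved by induction.\<close>
  have "(\<Oplus>i\<in>{..<n}. f (Suc i)) \<oplus> f 0 = (\<Oplus>i\<in>{..<n}. f i) \<oplus> f n"
  proof (induction n)
    case (Suc n)
    have "(\<Oplus>i\<in>{..<Suc n}. f (Suc i)) \<oplus> f 0 = f (Suc n) \<oplus> ((\<Oplus>i\<in>{..<n}. f (Suc i)) \<oplus> f 0)"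
      using f by (simp add: lessThan_Suc finsum_closed a_assoc)
    also have "\<dots> = (\<Oplus>i\<in>{..<Suc n}. f i) \<oplus> f (Suc n)"
      unfolding Suc.IH using f by (simp add: lessThan_Suc finsum_closed a_ac)
    finally show ?case .
  qed simp
  then show ?thesis using assms by (simp add: finsum_closed)
qed

context skew_field
begin

text \<open>Multiplication by \<open>u\<close> only shifts the summands cyclically, so the sum
  \<open>s\<close> satisfies \<open>s u = s\<close>; a nonzero \<open>s\<close> could be
  cancelled.\<close>

lemma geometric_sum_root_of_unity:
  assumes u: "u \<in> carrier R" "u [^] (n::nat) = \<one>" "u \<noteq> \<one>"
  shows "(\<Oplus>j\<in>{..<n}. u [^] j) = \<zero>"
proof -
  let ?s = "\<Oplus>j\<in>{..<n}. u [^] j"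
  have s: "?s \<in> carrier R" using u by (auto intro: finsum_closed)
  have "?s \<otimes> u = (\<Oplus>j\<in>{..<n}. u [^] Suc j)"
    using u by (subst finsum_ldistr) auto
  also have "\<dots> = ?s" using u by (intro finsum_cyclic_shift) auto
  finally have "?s \<otimes> u = ?s \<otimes> \<one>" using s by simp
  then show ?thesis using u s mult_left_cancel[of ?s u \<one>] by auto
qed

lemma add_pow_one_central: "x \<in> carrier R \<Longrightarrow> add_pow R (n::nat) \<one> \<otimes> x = x \<otimes> add_pow R n \<one>"
  by (simp add: add_pow_ldistr add_pow_rdistr)

text \<open>The exact order divides \<open>m\<close>, so it is nonzero in the ring whenever
  \<open>m\<close> is.\<close>

lemma pow_one_exact_order:
  assumes a: "a \<in> carrier R" "a [^] (m::nat) = \<one>" "add_pow R m \<one> \<noteq> \<zero>"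
  obtains n :: nat where "n > 0" "a [^] n = \<one>" "add_pow R n \<one> \<noteq> \<zero>"
    "\<And>i. 0 < i \<Longrightarrow> i < n \<Longrightarrow> a [^] i \<noteq> \<one>"
proof -
  have m: "m > 0" using a(3) by (cases m) auto
  define n where "n = (LEAST n::nat. n > 0 \<and> a [^] n = \<one>)"
  have n: "n > 0 \<and> a [^] n = \<one>" unfolding n_def
    using LeastI[of "\<lambda>n. n > 0 \<and> a [^] n = \<one>" m] a m by simp
  have min: "a [^] i \<noteq> \<one>" if "0 < i" "i < n" for i
    using that not_less_Least[of i "\<lambda>n::nat. n > 0 \<and> a [^] n = \<one>"] unfolding n_def by auto
  have "a [^] m = (a [^] n) [^] (m div n) \<otimes> a [^] (m mod n)"
    using a(1) by (simp only: nat_pow_pow nat_pow_mult mult_div_mod_eq)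
  then have "a [^] (m mod n) = \<one>" using a n by simp
  then have "m mod n = 0" using min[of "m mod n"] n by auto
  then obtain k where k: "m = n * k" by auto
  have "add_pow R m \<one> = \<zero>" if "add_pow R n \<one> = \<zero>"
    using that unfolding k by (simp flip: add.nat_pow_pow)
  then show thesis using that[of n] n min a(3) by blast
qed

text \<open>
  The elements \<open>p j\<close> below are, up to the scalar \<open>n\<close>, the components of \<open>x\<close> in the eigenspaces
  of conjugation by \<open>a\<close>, the eigenvalues being the powers of \<open>a\<close> acting by left multiplication.
\<close>

lemma exists_normalizing_element:
  assumes a: "a \<in> carrier R" "a [^] (m::nat) = \<one>" "add_pow R m \<one> \<noteq> \<zero>"
    and x: "x \<in> carrier R" "a \<otimes> x \<noteq> x \<otimes> a"
  shows "\<exists>y i. y \<in> carrier R \<and> y \<noteq> \<zero> \<and> y \<otimes> a = a [^] (i::nat) \<otimes> y \<and> a [^] i \<noteq> a"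
proof -
  obtain n :: nat where n: "n > 0" "a [^] n = \<one>" "add_pow R n \<one> \<noteq> \<zero>"
    and exact: "\<And>i. 0 < i \<Longrightarrow> i < n \<Longrightarrow> a [^] i \<noteq> \<one>"
    using pow_one_exact_order[OF a] by blast
  have a0: "a \<noteq> \<zero>" using pow_eq_one_nonzero[OF a(1) n(2,1)] .
  define b where "b = inv a"
  have b: "b \<in> carrier R" "a \<otimes> b = \<one>" "b \<otimes> a = \<one>" using a a0 by (auto simp: b_def)
  have ba: "b [^] k \<otimes> a [^] k = \<one>" "a [^] k \<otimes> b [^] k = \<one>" for k :: nat
    using inv_pow_eq[OF a(1) a0] by (auto simp: b_def)
  have bn: "b [^] n = \<one>" using ba(1)[of n] n a b by simp
  have b_pow: "b [^] i \<noteq> \<one>" if "0 < i" "i < n" for i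
    using ba(1)[of i] exact[OF that] a by auto
  \<comment> \<open>The conjugates \<open>g i\<close> of \<open>x\<close> have period
    \<open>n\<close>, and \<open>p\<close> is their discrete Fourier transform with
    \<open>b = inv a\<close> as root of unity. Conjugation by \<open>a\<close> shifts
    \<open>i\<close> by one, at the cost of the factor \<open>a^j\<close>.\<close>
  define g where "g i = a [^] i \<otimes> x \<otimes> b [^] i" for i :: nat
  define f where "f j i = (b [^] i) [^] j \<otimes> g i" for j i :: nat
  define p where "p j = (\<Oplus>i\<in>{..<n}. f j i)" for j
  have g: "g i \<in> carrier R" for i using a b x by (simp add: g_def)
  have f: "f j i \<in> carrier R" for j i using b g by (simp add: f_def)
  have p: "p j \<in> carrier R" for j unfolding p_def using f by (auto intro: finsum_closed)
  have step: "a \<otimes> f j i \<otimes> b = a [^] j \<otimes> f j (Suc i)" for j i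
  proof -
    let ?c = "(b [^] i) [^] j"
    have "?c \<otimes> a = a \<otimes> ?c"
      by (intro group_commutes_pow) (use a b in auto)
    then have "a \<otimes> f j i \<otimes> b = ?c \<otimes> (a \<otimes> g i \<otimes> b)"
      unfolding f_def using a b g by (simp flip: m_assoc)
    also have "a \<otimes> g i \<otimes> b = g (Suc i)"
      using nat_pow_Suc2[OF a(1), of i]
      unfolding g_def using a b x by (simp flip: m_assoc)
    finally have 1: "a \<otimes> f j i \<otimes> b = ?c \<otimes> g (Suc i)" .
    have "b [^] i \<otimes> b = b \<otimes> b [^] i" using b nat_pow_Suc2[of b i] by simp
    then have "(b [^] Suc i) [^] j = b [^] j \<otimes> ?c"
      using pow_mult_distrib[of b "b [^] i" j] b by simp
    then have "a [^] j \<otimes> f j (Suc i) = (a [^] j \<otimes> b [^] j) \<otimes> (?c \<otimes> g (Suc i))"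
      unfolding f_def using a b g[of "Suc i"] by (simp add: m_assoc)
    then show ?thesis using 1 ba b g by simp
  qed
  have eigen: "a \<otimes> p j \<otimes> b = a [^] j \<otimes> p j" for j
  proof -
    have "a \<otimes> p j \<otimes> b = (\<Oplus>i\<in>{..<n}. a \<otimes> f j i \<otimes> b)"
      unfolding p_def using a b f by (simp add: finsum_rdistr finsum_ldistr Pi_def)
    also have "\<dots> = a [^] j \<otimes> (\<Oplus>i\<in>{..<n}. f j (Suc i))"
      unfolding step using a b f by (simp add: finsum_rdistr Pi_def)
    also have "(\<Oplus>i\<in>{..<n}. f j (Suc i)) = p j"
      unfolding p_def using f n bn a b x by (intro finsum_cyclic_shift) (auto simp: f_def g_def)
    finally show ?thesis .
  qed
  have comm: "a \<otimes> p j = a [^] j \<otimes> p j \<otimes> a" for j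
    using arg_cong[OF eigen[of j], of "\<lambda>u. u \<otimes> a"] a b p by (simp add: m_assoc)
  \<comment> \<open>Fourier inversion at index 0: for \<open>0 < i < n\<close> the sum over
    \<open>j\<close> is geometric in \<open>b^i\<close>, which is not one because \<open>n\<close>
    is the exact order, so only \<open>n\<close> copies of \<open>g 0 = x\<close> remain.\<close>
  have total: "(\<Oplus>j\<in>{..<n}. p j) = add_pow R n x"
  proof -
    have "(\<Oplus>j\<in>{..<n}. p j) = (\<Oplus>i\<in>{..<n}. \<Oplus>j\<in>{..<n}. f j i)"
      unfolding p_def using f by (intro finsum_swap) auto
    also have "\<dots> = (\<Oplus>i\<in>{..<n}. if 0 = i then add_pow R n x else \<zero>)"
    proof (rule finsum_cong')
      fix i assume i: "i \<in> {..<n}"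
      have *: "(\<Oplus>j\<in>{..<n}. f j i) = (\<Oplus>j\<in>{..<n}. (b [^] i) [^] j) \<otimes> g i"
        unfolding f_def using b g by (simp add: finsum_ldistr Pi_def)
      show "(\<Oplus>j\<in>{..<n}. f j i) = (if 0 = i then add_pow R n x else \<zero>)"
      proof (cases "i = 0")
        case True
        then have "(\<Oplus>j\<in>{..<n}. (b [^] i) [^] j) = (\<Oplus>j\<in>{..<n}. \<one>)"
          by (intro finsum_cong') auto
        then show ?thesis unfolding * using True using x add.finprod_const[of \<one> "{..<n}"]
          by (simp add: g_def add_pow_ldistr del: nat_pow_one)
      next
        case False
        have "(b [^] i) [^] n = \<one>"
          using b bn by (metis mult.commute nat_pow_one nat_pow_pow)
        then have "(\<Oplus>j\<in>{..<n}. (b [^] i) [^] j) = \<zero>"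
          using b b_pow[of i] False i by (intro geometric_sum_root_of_unity) auto
        then show ?thesis unfolding * using False g by simp
      qed
    qed (use x in auto)
    also have "\<dots> = add_pow R n x"
      using add.finprod_singleton[of 0 "{..<n}" "\<lambda>_. add_pow R n x"] n x
      by simp
    finally show ?thesis .
  qed
  \<comment> \<open>If the other components all vanished, \<open>n x = p 0\<close> would commute
    with \<open>a\<close>; then so would \<open>x\<close>, because \<open>n\<close> is central and
    nonzero in the ring.\<close>
  have "\<exists>j. 0 < j \<and> j < n \<and> p j \<noteq> \<zero>"
  proof (rule ccontr)
    assume "\<not> (\<exists>j. 0 < j \<and> j < n \<and> p j \<noteq> \<zero>)"
    then have z: "p j = \<zero>" if "0 < j" "j < n" for j using that by auto
    have "(\<Oplus>j\<in>{..<n}. p j) = (\<Oplus>j\<in>{..<n}. if 0 = j then p 0 else \<zero>)"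
      using z p by (intro finsum_cong') auto
    also have "\<dots> = p 0"
      using add.finprod_singleton[of 0 "{..<n}" "\<lambda>_. p 0"] n p
      by simp
    finally have "p 0 = add_pow R n \<one> \<otimes> x" using total x by (simp add: add_pow_ldistr)
    then have "add_pow R n \<one> \<otimes> (a \<otimes> x) = add_pow R n \<one> \<otimes> (x \<otimes> a)"
      using comm[of 0] a x add_pow_one_central[of a n] p[of 0] by (simp flip: m_assoc)
    then show False using mult_left_cancel[of "add_pow R n \<one>" "a \<otimes> x" "x \<otimes> a"] n a x by simp
  qed
  then obtain j where j: "0 < j" "j < n" "p j \<noteq> \<zero>" by blast
  \<comment> \<open>The eigenvalue equation gives \<open>p j\<close> times \<open>a\<close> as
    \<open>a^(1-j)\<close> times \<open>p j\<close>; since \<open>inv a = a^(n-1)\<close>, the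
    exponent can be taken as the natural number \<open>1 + (n-1) j\<close>.\<close>
  have bk: "b = a [^] (n - 1)"
  proof -
    have "a [^] (n - 1) \<otimes> a = b \<otimes> a" using n b by (simp flip: nat_pow_Suc)
    then show ?thesis using mult_right_cancel[of a b "a [^] (n - 1)"] a a0 b by simp
  qed
  have "p j \<otimes> a = b [^] j \<otimes> (a [^] j \<otimes> p j \<otimes> a)"
    using a b p ba by (simp flip: m_assoc)
  also have "\<dots> = (b [^] j \<otimes> a) \<otimes> p j" using a b p by (simp add: m_assoc flip: comm)
  also have "b [^] j \<otimes> a = a [^] Suc ((n - 1) * j)"
    unfolding bk using a by (simp add: nat_pow_pow)
  finally have 2: "p j \<otimes> a = a [^] Suc ((n - 1) * j) \<otimes> p j" .
  have "a [^] Suc ((n - 1) * j) \<noteq> a"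
  proof
    assume "a [^] Suc ((n - 1) * j) = a"
    then have "b [^] j \<otimes> a = \<one> \<otimes> a" unfolding bk using a by (simp add: nat_pow_pow)
    then show False using b_pow[OF j(1,2)] mult_right_cancel[of a "b [^] j" \<one>] a a0 b by simp
  qed
  then show ?thesis using 2 p j by blast
qed

end

section \<open>Centres and centralizers\<close>

text \<open>In a counterexample, cyclicity of the unit group (two nonsquares multiply to a square)
  forces the squares to be closed under addition. Then -1 is a square and an explicit identity
  represents \<open>a\<close>. This solves the norm equation in the quaternion case of Wedderburn's
  theorem.\<close>

lemma (in field) sum_of_two_squares:
  assumes fin: "finite (carrier R)" and a: "a \<in> carrier R"
  shows "\<exists>x\<in>carrier R. \<exists>y\<in>carrier R. a = x \<otimes> x \<oplus> y \<otimes> y"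
proof (rule ccontr)
  assume contra: "\<not> ?thesis"
  define Q where "Q = (\<lambda>x. x \<otimes> x) ` carrier R"
  have Q_carrier: "s \<in> carrier R" if "s \<in> Q" for s using that by (auto simp: Q_def)
  have a_sum: "a \<noteq> s \<oplus> t" if "s \<in> Q" "t \<in> Q" for s t
    using contra that unfolding Q_def by blast
  obtain g where g: "g \<in> carrier R" "g \<noteq> \<zero>"
    and gen: "carrier R - {\<zero>} = {g [^] i | i::nat. i \<in> UNIV}"
    using finite_field_mult_group_has_gen[OF fin] by (auto simp: mult_of_simps)
  have Q_mult: "s \<otimes> t \<in> Q" if st: "s \<in> Q" "t \<in> Q" for s t
  proof -
    obtain x y where "x \<in> carrier R" "s = x \<otimes> x" "y \<in> carrier R" "t = y \<otimes> y"
      using st by (auto simp: Q_def)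
    then have "s \<otimes> t = (x \<otimes> y) \<otimes> (x \<otimes> y)" "x \<otimes> y \<in> carrier R" by (auto simp: m_ac)
    then show ?thesis by (auto simp: Q_def)
  qed
  have Q0: "\<zero> \<in> Q" unfolding Q_def by (rule image_eqI[of _ _ \<zero>]) auto
  have even: "g [^] (i + i) \<in> Q" for i :: nat
    unfolding Q_def using g by (auto simp: nat_pow_mult[symmetric])
  have nonsq: "s \<otimes> t \<in> Q" if s: "s \<in> carrier R - Q" and t: "t \<in> carrier R - Q" for s t
  proof -
    have "s \<in> carrier R - {\<zero>}" "t \<in> carrier R - {\<zero>}" using s t Q0 by auto
    then obtain i j :: nat where ij: "s = g [^] i" "t = g [^] j" unfolding gen by blast
    have "odd i" "odd j" using s t ij even by (auto elim!: evenE simp flip: mult_2)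
    then obtain k where "i + j = k + k" by (metis evenE mult_2 odd_even_add)
    then show ?thesis using even[of k] ij g by (simp add: nat_pow_mult)
  qed
  have a_nonsq: "a \<in> carrier R - Q" using a_sum[OF _ Q0] a Q_carrier by force
  \<comment> \<open>If \<open>s + t\<close> were a nonsquare, \<open>a (s + t)\<close> would be a
    square, and so would its quotient \<open>w\<close> by \<open>(s + t)^2\<close>; but
    \<open>a = s w + t w\<close>.\<close>
  have Q_add: "s \<oplus> t \<in> Q" if st: "s \<in> Q" "t \<in> Q" for s t
  proof (rule ccontr)
    assume "s \<oplus> t \<notin> Q"
    then have u: "s \<oplus> t \<in> carrier R - Q" using st Q_carrier by auto
    then have u0: "s \<oplus> t \<noteq> \<zero>" using Q0 by auto
    have U: "s \<oplus> t \<in> Units R" using u u0 by (simp add: field_Units)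
    define w where "w = inv (s \<oplus> t)"
    have w: "w \<in> carrier R" "(s \<oplus> t) \<otimes> w = \<one>" using U by (auto simp: w_def)
    define v where "v = w \<otimes> w"
    have v: "v \<in> Q" unfolding v_def Q_def using w by auto
    have "(a \<otimes> (s \<oplus> t)) \<otimes> v \<in> Q"
      using nonsq[OF a_nonsq u] v Q_mult by blast
    then have "(s \<otimes> ((a \<otimes> (s \<oplus> t)) \<otimes> v)) \<in> Q" "(t \<otimes> ((a \<otimes> (s \<oplus> t)) \<otimes> v)) \<in> Q"
      using st Q_mult by blast+
    moreover have "a = s \<otimes> ((a \<otimes> (s \<oplus> t)) \<otimes> v) \<oplus> t \<otimes> ((a \<otimes> (s \<oplus> t)) \<otimes> v)"
    proof -
      have "s \<otimes> ((a \<otimes> (s \<oplus> t)) \<otimes> v) \<oplus> t \<otimes> ((a \<otimes> (s \<oplus> t)) \<otimes> v) =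
          a \<otimes> ((s \<oplus> t) \<otimes> w) \<otimes> ((s \<oplus> t) \<otimes> w)"
        unfolding v_def using Q_carrier[OF st(1)] Q_carrier[OF st(2)] a w(1) by algebra
      then show ?thesis using a w(2) by simp
    qed
    ultimately show False using a_sum by blast
  qed
  have "add_pow R n \<one> \<in> Q" for n :: nat
  proof (induction n)
    case (Suc n)
    have "\<one> \<in> Q" unfolding Q_def by (rule image_eqI[of _ _ \<one>]) auto
    then show ?case using Suc Q_add by simp
  qed (simp add: Q0)
  moreover have "\<ominus> \<one> = add_pow R (card (carrier R) - 1) \<one>"
  proof -
    have "add_pow R (card (carrier R)) \<one> = \<zero>"
      using add.pow_order_eq_1[of \<one>] by (simp add: order_def)
    moreover obtain m where m: "card (carrier R) = Suc m"
      using fin by (cases "card (carrier R)") auto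
    ultimately show ?thesis by (intro minus_equality) simp_all
  qed
  ultimately have neg: "\<ominus> \<one> \<in> Q" by simp
  have sq: "a \<otimes> a \<in> Q" using a by (auto simp: Q_def)
  have one: "\<one> \<in> Q" unfolding Q_def by (rule image_eqI[of _ _ \<one>]) auto
  show False
  \<comment> \<open>Two ways to write \<open>a\<close>: as \<open>(1 + a) + (-1)\<close>, or as
    \<open>(1 + a) a + (-1) a^2\<close>, where \<open>(1 + a) a\<close> is a product of two
    nonsquares.\<close>
  proof (cases "\<one> \<oplus> a \<in> Q")
    case True
    have "a = (\<one> \<oplus> a) \<oplus> \<ominus> \<one>" using a by algebra
    then show False using a_sum True neg by blast
  next
    case False
    then have "(\<one> \<oplus> a) \<otimes> a \<in> Q" using nonsq a_nonsq a by simp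
    moreover have "\<ominus> \<one> \<otimes> (a \<otimes> a) \<in> Q" using neg sq Q_mult by blast
    moreover have "a = (\<one> \<oplus> a) \<otimes> a \<oplus> \<ominus> \<one> \<otimes> (a \<otimes> a)" using a by algebra
    ultimately show False using a_sum by blast
  qed
qed

section \<open>Centralizers, the center and conjugation of powers\<close>

context skew_field
begin

lemma commutative_imp_field:
  assumes "\<And>x y. x \<in> carrier R \<Longrightarrow> y \<in> carrier R \<Longrightarrow> x \<otimes> y = y \<otimes> x"
  shows "field R"
  by unfold_locales (use assms one_not_zero integral skew_field_Units in auto)

lemma pow_coprime_eq_one:
  assumes x: "x \<in> carrier R" "x \<noteq> \<zero>" and "x [^] (k::nat) = \<one>" "x [^] (r::nat) = \<one>" "coprime k r"
  shows "x = \<one>"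
proof -
  interpret U: group "units_of R" by (rule units_group)
  have xU: "x \<in> carrier (units_of R)" using x by (simp add: units_of_carrier Units_iff)
  then have "U.ord x dvd k" "U.ord x dvd r"
    using assms U.pow_eq_id[OF xU]
    by (simp_all add: units_of_pow units_of_one units_of_carrier)
  then have "U.ord x = 1" using assms(5) by (meson coprime_common_divisor_nat)
  then show ?thesis using U.pow_ord_eq_1[OF xU] xU x by (simp add: units_of_pow units_of_one units_of_carrier)
qed

lemma centralizer_subring:
  assumes "x \<in> carrier R"
  shows "subring {w \<in> carrier R. x \<otimes> w = w \<otimes> x} R"
proof (rule subringI)
  fix h1 h2 assume h: "h1 \<in> {w \<in> carrier R. x \<otimes> w = w \<otimes> x}" "h2 \<in> {w \<in> carrier R. x \<otimes> w = w \<otimes> x}"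
  have "x \<otimes> (h1 \<otimes> h2) = (h1 \<otimes> x) \<otimes> h2" using h assms by (simp flip: m_assoc)
  also have "\<dots> = h1 \<otimes> (h2 \<otimes> x)" using h assms by (simp add: m_assoc)
  finally have "x \<otimes> (h1 \<otimes> h2) = h1 \<otimes> (h2 \<otimes> x)" .
  then show "h1 \<otimes> h2 \<in> {w \<in> carrier R. x \<otimes> w = w \<otimes> x}" using h assms by (simp add: m_assoc)
qed (use assms in \<open>auto simp: l_minus r_minus l_distr r_distr\<close>)

lemma center_closed: "z \<in> ring_center R \<Longrightarrow> z \<in> carrier R"
  by (simp add: ring_center_def)

lemma center_commute: "z \<in> ring_center R \<Longrightarrow> x \<in> carrier R \<Longrightarrow> z \<otimes> x = x \<otimes> z"
  by (simp add: ring_center_def)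

lemma centerI:
  "z \<in> carrier R \<Longrightarrow> (\<And>x. x \<in> carrier R \<Longrightarrow> z \<otimes> x = x \<otimes> z) \<Longrightarrow> z \<in> ring_center R"
  by (simp add: ring_center_def)

lemma center_subring: "subring (ring_center R) R"
proof (rule subringI)
  fix h1 h2 assume h: "h1 \<in> ring_center R" "h2 \<in> ring_center R"
  note c = h[THEN center_closed]
  show "h1 \<otimes> h2 \<in> ring_center R"
  proof (rule centerI)
    fix x assume x: "x \<in> carrier R"
    have "h1 \<otimes> h2 \<otimes> x = h1 \<otimes> (h2 \<otimes> x)" using c x by (simp add: m_assoc)
    also have "\<dots> = (h1 \<otimes> x) \<otimes> h2" unfolding center_commute[OF h(2) x] using c x by (simp add: m_assoc)
    also have "\<dots> = x \<otimes> (h1 \<otimes> h2)" unfolding center_commute[OF h(1) x] using c x by (simp add: m_assoc)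
    finally show "h1 \<otimes> h2 \<otimes> x = x \<otimes> (h1 \<otimes> h2)" .
  qed (use c in simp)
  show "h1 \<oplus> h2 \<in> ring_center R"
    by (rule centerI) (use c in \<open>simp_all add: l_distr r_distr center_commute[OF h(1)] center_commute[OF h(2)]\<close>)
next
  fix h assume h: "h \<in> ring_center R"
  show "\<ominus> h \<in> ring_center R"
    by (rule centerI) (use center_closed[OF h] in \<open>simp_all add: l_minus r_minus center_commute[OF h]\<close>)
qed (auto intro: centerI dest: center_closed)

lemma conj_pow_right:
  assumes "a \<in> carrier R" "y \<in> carrier R" "d \<in> carrier R" "y \<otimes> a = d \<otimes> y"
  shows "y \<otimes> a [^] (k::nat) = d [^] k \<otimes> y"
proof (induction k)
  case (Suc k)
  have "y \<otimes> a [^] Suc k = d [^] k \<otimes> (y \<otimes> a)"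
    using assms(1-3) by (simp flip: m_assoc Suc.IH)
  then show ?case using assms by (simp add: m_assoc)
qed (use assms in simp)

lemma conj_pow_left:
  assumes "a \<in> carrier R" "y \<in> carrier R" "y \<otimes> a = a [^] (i::nat) \<otimes> y"
  shows "y [^] (k::nat) \<otimes> a = a [^] (i ^ k) \<otimes> y [^] k"
proof (induction k)
  case (Suc k)
  have "y [^] Suc k \<otimes> a = y [^] k \<otimes> a [^] i \<otimes> y"
    using assms by (simp add: m_assoc)
  also have "\<dots> = (a [^] (i ^ k)) [^] i \<otimes> y [^] k \<otimes> y"
    using conj_pow_right[OF _ _ _ Suc.IH, of i] assms by simp
  also have "\<dots> = a [^] (i ^ Suc k) \<otimes> y [^] Suc k"
    using assms by (simp add: nat_pow_pow m_assoc mult.commute)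
  finally show ?case .
qed (use assms in \<open>simp\<close>)

end

section \<open>Wedderburn's theorem\<close>

text \<open>The induction step of Wedderburn's theorem: a proper subring of a finite division ring
  is a smaller division ring, commutative by the induction hypothesis.\<close>

locale minimal_finite_skew_field = skew_field +
  assumes finite_carrier: "finite (carrier R)"
    and proper_subring_commutative:
      "subring S R \<Longrightarrow> S \<noteq> carrier R \<Longrightarrow> x \<in> S \<Longrightarrow> y \<in> S \<Longrightarrow> x \<otimes> y = y \<otimes> x"
begin

abbreviation "Z \<equiv> ring_center R"

text \<open>The centralizer of a noncentral element is a proper subring.\<close>

lemma centralizer_commutative:
  assumes x: "x \<in> carrier R" "x \<notin> Z"
    and "u \<in> carrier R" "x \<otimes> u = u \<otimes> x" "v \<in> carrier R" "x \<otimes> v = v \<otimes> x"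
  shows "u \<otimes> v = v \<otimes> u"
proof (rule proper_subring_commutative[OF centralizer_subring[OF x(1)]])
  obtain w where "w \<in> carrier R" "x \<otimes> w \<noteq> w \<otimes> x" using x centerI by blast
  then show "{w \<in> carrier R. x \<otimes> w = w \<otimes> x} \<noteq> carrier R" by auto
qed (use assms in auto)

lemma center_inv: "z \<in> Z \<Longrightarrow> z \<noteq> \<zero> \<Longrightarrow> inv z \<in> Z"
  using finite_subring_inv[OF center_subring finite_subset[OF _ finite_carrier]] center_closed by blast

lemma center_pow: "z \<in> Z \<Longrightarrow> z [^] (k::nat) \<in> Z"
  by (induction k) (auto intro: subringE(3,6)[OF center_subring])

lemma center_mult: "z \<in> Z \<Longrightarrow> w \<in> Z \<Longrightarrow> z \<otimes> w \<in> Z"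
  using subringE(6)[OF center_subring] .

lemma central_factor:
  assumes "z \<in> Z" "z \<noteq> \<zero>" "x \<in> carrier R" "x \<otimes> z \<in> Z"
  shows "x \<in> Z"
proof -
  have "x \<otimes> z \<otimes> inv z \<in> Z" using assms center_inv center_mult by blast
  then show ?thesis using assms center_closed by (simp add: m_assoc)
qed

lemma center_field: "field (R\<lparr>carrier := Z\<rparr>)"
proof -
  interpret ZZ: skew_field "R\<lparr>carrier := Z\<rparr>"
    by (intro subring_skew_field center_subring center_inv)
  show ?thesis by (rule ZZ.commutative_imp_field) (simp add: center_closed center_commute)
qed

lemma center_generator:
  obtains g where "g \<in> Z" "g \<noteq> \<zero>" "\<And>z. z \<in> Z \<Longrightarrow> z \<noteq> \<zero> \<Longrightarrow> \<exists>i::nat. z = g [^] i"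
proof -
  interpret Z: field "R\<lparr>carrier := Z\<rparr>" by (rule center_field)
  have "finite Z" using finite_subset[OF _ finite_carrier] center_closed by blast
  then obtain g where g: "g \<in> Z - {\<zero>}" "Z - {\<zero>} = {g [^] i | i::nat. i \<in> UNIV}"
    using Z.finite_field_mult_group_has_gen by (auto simp: mult_of_simps simp flip: nat_pow_consistent)
  show thesis by (rule that[of g]) (use g in blast)+
qed

text \<open>If \<open>e\<close> were noncentral, its centralizer would be a field containing
  \<open>e\<close> and the \<open>r\<close> distinct central powers of \<open>l\<close>: too many
  roots of \<open>X^r - 1\<close>.\<close>

lemma roots_of_unity_central:
  assumes r: "Factorial_Ring.prime r" and l: "l \<in> Z" "l [^] r = \<one>" "l \<noteq> \<one>"
    and e: "e \<in> carrier R" "e [^] (r::nat) = \<one>"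
  shows "e \<in> Z"
proof (rule ccontr)
  assume eZ: "e \<notin> Z"
  define C where "C = {w \<in> carrier R. e \<otimes> w = w \<otimes> e}"
  have C: "subring C R" unfolding C_def using e by (intro centralizer_subring)
  have fin: "finite C" unfolding C_def using finite_carrier by simp
  interpret C: skew_field "R\<lparr>carrier := C\<rparr>" by (rule finite_subring_skew_field[OF C fin])
  interpret C: field "R\<lparr>carrier := C\<rparr>"
    by (rule C.commutative_imp_field) (use centralizer_commutative e eZ in \<open>auto simp: C_def\<close>)
  have r0: "r > 0" using r prime_gt_0_nat by blast
  have l0: "l \<in> carrier R" "l \<noteq> \<zero>"
    using l center_closed pow_eq_one_nonzero[OF _ l(2) r0] by auto
  have "card {x \<in> C. x [^] r = \<one>} \<le> r"
    using C.num_roots_le_deg[of r] fin r0 by (simp flip: nat_pow_consistent)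
  moreover have inj: "inj_on (\<lambda>i. l [^] i) {..<r}"
  proof -
    have "l [^] i \<noteq> l [^] j" if ij: "i < j" "j < r" for i j
    proof
      assume "l [^] i = l [^] j"
      moreover have "l [^] i \<otimes> l [^] (j - i) = l [^] j" using ij l0 by (simp add: nat_pow_mult)
      ultimately have "l [^] i \<otimes> l [^] (j - i) = l [^] i \<otimes> \<one>" using l0 by simp
      then have "l [^] (j - i) = \<one>"
        using mult_left_cancel[of "l [^] i" "l [^] (j - i)" \<one>] l0 pow_nonzero by simp
      moreover have "coprime (j - i) r"
      proof -
        have "\<not> r dvd j - i" using ij by (auto dest: dvd_imp_le)
        then show ?thesis using r prime_imp_coprime coprime_commute by blast
      qed
      ultimately show False using pow_coprime_eq_one[OF l0 _ l(2)] l(3) by blast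
    qed
    then show ?thesis unfolding inj_on_def by (metis lessThan_iff linorder_neqE_nat)
  qed
  moreover have "insert e ((\<lambda>i. l [^] i) ` {..<r}) \<subseteq> {x \<in> C. x [^] r = \<one>}"
  proof -
    have "l [^] i \<in> C" for i :: nat
      using center_commute[OF center_pow[OF l(1), of i] e(1)] l0 by (simp add: C_def)
    moreover have "(l [^] i) [^] r = \<one>" for i :: nat
    proof -
      have "(l [^] i) [^] r = (l [^] r) [^] i" using l0 by (simp add: nat_pow_pow mult.commute)
      then show ?thesis using l by simp
    qed
    ultimately show ?thesis using e by (auto simp: C_def)
  qed
  moreover have new: "e \<notin> (\<lambda>i. l [^] i) ` {..<r}" using center_pow l(1) eZ by auto
  moreover have "finite {x \<in> C. x [^] r = \<one>}" using fin by simp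
  ultimately have "card (insert e ((\<lambda>i. l [^] i) ` {..<r})) \<le> r"
    by (meson card_mono le_trans)
  then show False using new inj by (simp add: card_image)
qed

text \<open>Otherwise \<open>x (inv s)\<close> would be an \<open>r\<close>-th root of unity, hence
  central, and \<open>x\<close> with it.\<close>

lemma not_central_root:
  assumes r: "Factorial_Ring.prime r" and l: "l \<in> Z" "l [^] r = \<one>" "l \<noteq> \<one>"
    and x: "x \<in> carrier R" "x \<notin> Z" and s: "s \<in> Z" "s \<noteq> \<zero>"
  shows "x [^] (r::nat) \<noteq> s [^] r"
proof
  assume eq: "x [^] r = s [^] r"
  have i: "inv s \<in> Z" "inv s \<in> carrier R" "inv s \<noteq> \<zero>" "s \<in> carrier R"
    using s center_inv center_closed by auto
  have "(x \<otimes> inv s) [^] r = x [^] r \<otimes> inv s [^] r"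
    by (intro pow_mult_distrib) (use x i center_commute[OF i(1) x(1)] in auto)
  then have "(x \<otimes> inv s) [^] r = \<one>" using inv_pow_eq[of s r] s i eq by simp
  then have "x \<otimes> inv s \<in> Z" using roots_of_unity_central[OF r l] x i by simp
  then show False using central_factor[OF i(1,3) x(1)] x by simp
qed

lemma twisted_pow:
  assumes "l \<in> Z" "a \<in> carrier R" "c \<in> carrier R" "c \<otimes> a = l \<otimes> a \<otimes> c"
  shows "c [^] (k::nat) \<otimes> a = l [^] k \<otimes> a \<otimes> c [^] k"
proof (induction k)
  case (Suc k)
  have l: "l \<in> carrier R" using assms center_closed by blast
  have "c [^] Suc k \<otimes> a = c [^] k \<otimes> (l \<otimes> a \<otimes> c)" using assms by (simp add: m_assoc)
  also have "\<dots> = (c [^] k \<otimes> l) \<otimes> a \<otimes> c" using assms l by (simp add: m_assoc)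
  also have "\<dots> = (l \<otimes> c [^] k) \<otimes> a \<otimes> c"
    using center_commute[OF assms(1), of "c [^] k"] assms by simp
  also have "\<dots> = l \<otimes> (c [^] k \<otimes> a) \<otimes> c" using assms l by (simp add: m_assoc)
  also have "\<dots> = l [^] Suc k \<otimes> a \<otimes> c [^] Suc k"
    unfolding Suc.IH nat_pow_Suc2[OF l] using assms l by (simp add: m_assoc)
  finally show ?case .
qed (use assms in simp)

text \<open>Conjugation by \<open>c\<close> multiplies \<open>a^r\<close> by \<open>l^r\<close>, but
  fixes it because \<open>a^r\<close> is central.\<close>

lemma twisted_root_of_unity:
  assumes l: "l \<in> Z" and a: "a \<in> carrier R" and c: "c \<in> carrier R"
    and ca: "c \<otimes> a = l \<otimes> a \<otimes> c" and "a \<noteq> \<zero>" "c \<noteq> \<zero>" and ar: "a [^] (r::nat) \<in> Z"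
  shows "l [^] r = \<one>"
proof -
  have lc: "l \<in> carrier R" using l center_closed by blast
  have "c \<otimes> a [^] r = (l \<otimes> a) [^] r \<otimes> c"
    using conj_pow_right[of a c "l \<otimes> a" r] a c ca lc by simp
  also have "(l \<otimes> a) [^] r = l [^] r \<otimes> a [^] r"
    using pow_mult_distrib[of l a r] a lc center_commute[OF l] by simp
  finally have "l [^] r \<otimes> (a [^] r \<otimes> c) = \<one> \<otimes> (a [^] r \<otimes> c)"
    using center_commute[OF ar c] a c lc by (simp add: m_assoc)
  moreover have "a [^] r \<otimes> c \<noteq> \<zero>" using assms pow_nonzero mult_nonzero by simp
  ultimately show ?thesis
    using mult_right_cancel[of "a [^] r \<otimes> c" "l [^] r" \<one>] a c lc by simp
qed

text \<open>The triangular number counts how often a factor \<open>c\<close> has to pass a factor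
  \<open>a\<close>.\<close>

lemma twisted_mult_pow:
  assumes "l \<in> Z" "a \<in> carrier R" "c \<in> carrier R" "c \<otimes> a = l \<otimes> a \<otimes> c"
  shows "(a \<otimes> c) [^] (k::nat) = l [^] (k * (k - 1) div 2) \<otimes> (a [^] k \<otimes> c [^] k)"
proof (induction k)
  case (Suc k)
  have l: "l \<in> carrier R" using assms center_closed by blast
  let ?T = "k * (k - 1) div 2"
  have "k * (k - 1) + k * 2 = Suc k * k" by (cases k) (auto simp: algebra_simps)
  then have T: "Suc k * (Suc k - 1) div 2 = ?T + k"
    by (metis diff_Suc_1 div_mult_self1 mult.commute add.commute zero_neq_numeral)
  have "(a \<otimes> c) [^] Suc k = l [^] ?T \<otimes> a [^] k \<otimes> (c [^] k \<otimes> a) \<otimes> c"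
    using Suc.IH assms l by (simp add: m_assoc)
  also have "\<dots> = l [^] ?T \<otimes> (a [^] k \<otimes> l [^] k) \<otimes> a \<otimes> c [^] Suc k"
    unfolding twisted_pow[OF assms] using assms l by (simp add: m_assoc)
  also have "a [^] k \<otimes> l [^] k = l [^] k \<otimes> a [^] k"
    using center_commute[OF center_pow[OF assms(1)]] assms by simp
  also have "l [^] ?T \<otimes> (l [^] k \<otimes> a [^] k) \<otimes> a \<otimes> c [^] Suc k =
      (l [^] ?T \<otimes> l [^] k) \<otimes> (a [^] Suc k \<otimes> c [^] Suc k)"
    using assms l by (simp add: m_assoc)
  finally show ?case unfolding T using l by (simp add: nat_pow_mult)
qed (use assms in simp)

text \<open>
  For \<open>r = 2\<close> the elements \<open>a\<close> and \<open>c\<close> generate a quaternion algebra; it has zero divisors because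
  \<open>a\<^sup>2\<close> is a norm \<open>x\<^sup>2 + y\<^sup>2\<close> from the subfield generated by \<open>a c\<close>.
\<close>

lemma no_anticommuting_pair:
  assumes a: "a \<in> carrier R" "a \<noteq> \<zero>" "a \<otimes> a \<in> Z"
    and w: "w \<in> carrier R" "w \<otimes> w = \<ominus> \<one>" "w \<otimes> a = \<ominus> (a \<otimes> w)" "a \<otimes> w \<noteq> w \<otimes> a"
  shows False
proof -
  interpret Z: field "R\<lparr>carrier := Z\<rparr>" by (rule center_field)
  have "finite Z" using finite_subset[OF _ finite_carrier] center_closed by blast
  then obtain x y where xy: "x \<in> Z" "y \<in> Z" "a \<otimes> a = x \<otimes> x \<oplus> y \<otimes> y"
    using Z.sum_of_two_squares[of "a \<otimes> a"] a by auto
  note xyc = xy(1,2)[THEN center_closed]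
  \<comment> \<open>\<open>w\<close> is a square root of -1 commuting with the central
    \<open>x\<close> and \<open>y\<close>, so \<open>v\<close> and \<open>v'\<close> are conjugates
    with product \<open>x^2 + y^2 = a^2\<close>; \<open>a\<close> interchanges them because it
    anticommutes with \<open>w\<close>. Hence \<open>t = a v\<close> satisfies
    \<open>t^2 = (a^2)^2\<close>, and \<open>t\<close> is \<open>a^2\<close> or its negative, in
    either case central.\<close>
  define v where "v = x \<oplus> y \<otimes> w"
  define v' where "v' = x \<oplus> \<ominus> (y \<otimes> w)"
  have v: "v \<in> carrier R" "v' \<in> carrier R" using xyc w by (auto simp: v_def v'_def)
  have wy: "w \<otimes> y = y \<otimes> w" "w \<otimes> x = x \<otimes> w" "y \<otimes> x = x \<otimes> y"
    using center_commute xy w xyc by metis+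
  have av: "a \<otimes> v = v' \<otimes> a"
  proof -
    have "a \<otimes> (y \<otimes> w) = (y \<otimes> a) \<otimes> w"
      unfolding center_commute[OF xy(2) a(1)] using xyc w a by (simp add: m_assoc)
    also have "\<dots> = \<ominus> (y \<otimes> (w \<otimes> a))" using w a xyc by (simp add: m_assoc r_minus)
    finally show ?thesis unfolding v_def v'_def
      using a w xyc center_commute[OF xy(1) a(1)] by (simp add: r_distr l_distr l_minus m_assoc)
  qed
  have "v' \<otimes> v = x \<otimes> x \<oplus> x \<otimes> (y \<otimes> w) \<oplus> \<ominus> (y \<otimes> (w \<otimes> x)) \<oplus> \<ominus> (y \<otimes> ((w \<otimes> y) \<otimes> w))"
    unfolding v_def v'_def using xyc w(1) by algebra
  also have "\<dots> = x \<otimes> x \<oplus> (x \<otimes> y) \<otimes> w \<oplus> \<ominus> ((y \<otimes> x) \<otimes> w) \<oplus> \<ominus> (y \<otimes> (y \<otimes> (w \<otimes> w)))"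
    unfolding wy(1,2) using xyc w(1) by (simp add: m_assoc)
  also have "\<dots> = x \<otimes> x \<oplus> y \<otimes> y"
  proof -
    have "\<ominus> (y \<otimes> (y \<otimes> \<ominus> \<one>)) = y \<otimes> y" using xyc by (simp add: r_minus)
    then show ?thesis unfolding wy(3) w(2) using xyc w(1) by (simp add: a_assoc r_neg)
  qed
  finally have v'v: "v' \<otimes> v = a \<otimes> a" using xy(3) by simp
  define t where "t = a \<otimes> v"
  have t: "t \<in> carrier R" using a v by (simp add: t_def)
  have "t \<otimes> t = v' \<otimes> (a \<otimes> a) \<otimes> v"
    unfolding t_def using av a v by (metis m_assoc m_closed)
  also have "\<dots> = (a \<otimes> a) \<otimes> (v' \<otimes> v)"
    using a v by (simp add: m_assoc flip: center_commute[OF a(3) v(2)])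
  finally have tt: "t \<otimes> t = (a \<otimes> a) \<otimes> (a \<otimes> a)" using v'v by simp
  define s where "s = a \<otimes> a"
  have s: "s \<in> carrier R" "s \<in> Z" "s \<otimes> t = t \<otimes> s" "t \<otimes> t = s \<otimes> s"
    using a t tt center_commute by (auto simp: s_def)
  have "(t \<oplus> \<ominus> s) \<otimes> (t \<oplus> s) = t \<otimes> t \<oplus> (t \<otimes> s \<oplus> \<ominus> (s \<otimes> t)) \<oplus> \<ominus> (s \<otimes> s)"
    using s(1) t by algebra
  also have "\<dots> = \<zero>" unfolding s(3,4) using s(1) t by algebra
  finally have "t \<oplus> \<ominus> s = \<zero> \<or> t \<oplus> s = \<zero>" using integral s t by simp
  then have "t = s \<or> t = \<ominus> s"
  proof
    assume "t \<oplus> \<ominus> s = \<zero>"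
    then have "t = \<ominus> (\<ominus> s)" using s t by (intro minus_equality[symmetric]) auto
    then show ?thesis using s by simp
  next
    assume "t \<oplus> s = \<zero>"
    then have "t = \<ominus> s" using s t by (intro minus_equality[symmetric]) auto
    then show ?thesis ..
  qed
  then have tZ: "t \<in> Z" using s subringE(5)[OF center_subring] by auto
  \<comment> \<open>Both \<open>t = a v\<close> and \<open>v\<close> commute with \<open>w\<close>,
    so cancelling \<open>v\<close> makes \<open>a\<close> commute with \<open>w\<close>.\<close>
  have "v \<noteq> \<zero>" using v'v v a mult_nonzero[OF a(1,2) a(1,2)] by auto
  moreover have "w \<otimes> v = v \<otimes> w"
    unfolding v_def using xyc w(1) wy by (simp add: r_distr l_distr m_assoc flip: wy)
  ultimately have "(w \<otimes> a) \<otimes> v = (a \<otimes> w) \<otimes> v"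
    using center_commute[OF tZ w(1)] w(1) a v unfolding t_def by (simp add: m_assoc)
  then show False using mult_right_cancel[of v "w \<otimes> a" "a \<otimes> w"] \<open>v \<noteq> \<zero>\<close> v w a by auto
qed

text \<open>Let \<open>g\<close> generate the nonzero center, \<open>a^r = g^n\<close> and
  \<open>c^r = g^m\<close>. By \<open>not_central_root\<close>, \<open>r\<close> divides neither
  exponent, so a power of \<open>c\<close> times a central factor gives \<open>d\<close> with
  \<open>a^r d^r = 1\<close> that still twists \<open>a\<close> by a nontrivial root of unity
  \<open>u\<close>. For odd \<open>r\<close> this yields \<open>(a d)^r = 1\<close>, so
  \<open>a d\<close> is central although it does not commute with \<open>a\<close>; for
  \<open>r = 2\<close> it yields the quaternion case.\<close>

lemma no_twisted_pair:
  assumes r: "Factorial_Ring.prime r"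
    and min: "\<And>k x. 0 < k \<Longrightarrow> k < r \<Longrightarrow> x \<in> carrier R \<Longrightarrow> x \<notin> Z \<Longrightarrow> x [^] k \<notin> Z"
    and a: "a \<in> carrier R" "a \<notin> Z" "a [^] (r::nat) \<in> Z"
    and c: "c \<in> carrier R" "c \<notin> Z" "c [^] r \<in> Z"
    and l: "l \<in> Z" "l \<noteq> \<one>" "c \<otimes> a = l \<otimes> a \<otimes> c"
  shows False
proof -
  have r0: "r > 1" using r prime_gt_1_nat by blast
  have nonzero: "x \<noteq> \<zero>" if "x \<notin> Z" for x using that subringE(2)[OF center_subring] by auto
  have a0: "a \<noteq> \<zero>" and c0: "c \<noteq> \<zero>" using nonzero a c by auto
  have lc: "l \<in> carrier R" using l center_closed by blast
  have lr: "l [^] r = \<one>" using twisted_root_of_unity[OF l(1) a(1) c(1) l(3) a0 c0 a(3)] .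
  obtain g where g: "g \<in> Z" "g \<noteq> \<zero>"
    and gen: "\<And>z. z \<in> Z \<Longrightarrow> z \<noteq> \<zero> \<Longrightarrow> \<exists>i::nat. z = g [^] i"
    using center_generator by blast
  have gc: "g \<in> carrier R" using g center_closed by blast
  obtain n :: nat where n: "a [^] r = g [^] n" using gen[OF a(3)] a0 a pow_nonzero by blast
  obtain m :: nat where m: "c [^] r = g [^] m" using gen[OF c(3)] c0 c pow_nonzero by blast
  have not_dvd: "\<not> r dvd k" if x: "x \<in> carrier R" "x \<notin> Z" "x [^] r = g [^] k" for x and k :: nat
  proof
    assume "r dvd k"
    then obtain q where "k = q * r" by (metis dvdE mult.commute)
    then have "x [^] r = (g [^] q) [^] r" using x gc by (simp add: nat_pow_pow)
    then show False
      using not_central_root[OF r l(1) lr l(2) x(1,2) center_pow[OF g(1)]] pow_nonzero gc g by blast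
  qed
  have rn: "\<not> r dvd n" using not_dvd a n by blast
  have rm: "\<not> r dvd m" using not_dvd c m by blast
  obtain j where j: "0 < j" "j < r" "r dvd n + m * j"
  proof -
    have "coprime m r" using r rm prime_imp_coprime coprime_commute by blast
    then obtain x where x: "[m * x = 1] (mod r)" using cong_solve_coprime_nat by auto
    \<comment> \<open>\<open>x\<close> inverts \<open>m\<close> modulo \<open>r\<close>, and
      \<open>r - 1\<close> stands for -1, so \<open>m j\<close> is congruent to
      \<open>-n\<close>.\<close>
    define j where "j = (x * ((r - 1) * n)) mod r"
    have "[m * j = (m * x) * ((r - 1) * n)] (mod r)"
      unfolding j_def by (simp add: cong_def mod_mult_right_eq mult.assoc)
    also have "[(m * x) * ((r - 1) * n) = 1 * ((r - 1) * n)] (mod r)"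
      by (rule cong_mult[OF x cong_refl])
    finally have "[n + m * j = n + (r - 1) * n] (mod r)" by (simp add: cong_add_lcancel_nat)
    moreover have "n + (r - 1) * n = r * n" using r0 by (cases r) auto
    ultimately have "r dvd n + m * j" by (simp add: cong_dvd_iff)
    moreover have "j < r" using r0 by (simp add: j_def)
    moreover have "0 < j" using \<open>r dvd n + m * j\<close> rn by (cases j) auto
    ultimately show thesis using that by blast
  qed
  then obtain q where q: "n + m * j = q * r" by (metis dvdE mult.commute)
  \<comment> \<open>\<open>a^r\<close> times the \<open>r\<close>-th power of \<open>c^j\<close>
    equals \<open>g^(n + m j) = (g^q)^r\<close>; the factor \<open>h\<close> cancels it.\<close>
  define h where "h = inv (g [^] q)"
  have gq: "g [^] q \<in> Z" "g [^] q \<noteq> \<zero>" "g [^] q \<in> carrier R"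
    using g gc center_pow pow_nonzero by auto
  have h: "h \<in> Z" "h \<noteq> \<zero>" "h \<in> carrier R" using gq center_inv by (auto simp: h_def)
  define d where "d = c [^] j \<otimes> h"
  define u where "u = l [^] j"
  have uZ: "u \<in> Z" and uc: "u \<in> carrier R" using center_pow[OF l(1)] lc by (auto simp: u_def)
  have u1: "u \<noteq> \<one>"
  proof
    assume "u = \<one>"
    moreover have "coprime j r"
    proof -
      have "\<not> r dvd j" using j by (auto dest: dvd_imp_le)
      then show ?thesis using r prime_imp_coprime coprime_commute by blast
    qed
    moreover have "l \<noteq> \<zero>" using pow_eq_one_nonzero[OF lc lr] r0 by simp
    ultimately show False using pow_coprime_eq_one[OF lc _ _ lr] l(2) unfolding u_def by blast
  qed
  have dc: "d \<in> carrier R" using c h by (simp add: d_def)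
  have "c [^] j \<notin> Z" using min j c by blast
  then have dZ: "d \<notin> Z" using central_factor[OF h(1,2)] c by (auto simp: d_def)
  have da: "d \<otimes> a = u \<otimes> a \<otimes> d"
  proof -
    have "d \<otimes> a = c [^] j \<otimes> a \<otimes> h"
      unfolding d_def using center_commute[OF h(1) a(1)] c a h by (simp add: m_assoc)
    then show ?thesis
      unfolding twisted_pow[OF l(1) a(1) c(1) l(3)] d_def u_def using c a h lc by (simp add: m_assoc)
  qed
  have ad_r: "a [^] r \<otimes> d [^] r = \<one>"
  proof -
    have "d [^] r = (c [^] j) [^] r \<otimes> h [^] r"
      unfolding d_def using center_commute[OF h(1), of "c [^] j"] c h by (intro pow_mult_distrib) auto
    also have "(c [^] j) [^] r = (c [^] r) [^] j" using c by (simp add: nat_pow_pow mult.commute)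
    also have "\<dots> = g [^] (m * j)" using m gc by (simp add: nat_pow_pow)
    finally have "a [^] r \<otimes> d [^] r = (g [^] n \<otimes> g [^] (m * j)) \<otimes> h [^] r"
      using n gc h by (simp add: m_assoc)
    also have "\<dots> = (g [^] q) [^] r \<otimes> h [^] r" using gc q by (simp add: nat_pow_mult nat_pow_pow)
    also have "\<dots> = \<one>" unfolding h_def using inv_pow_eq[OF gq(3,2)] by simp
    finally show ?thesis .
  qed
  have not_comm: "a \<otimes> d \<noteq> d \<otimes> a"
  proof
    assume "a \<otimes> d = d \<otimes> a"
    then have "\<one> \<otimes> (a \<otimes> d) = u \<otimes> (a \<otimes> d)" using da a dc uc by (simp add: m_assoc)
    moreover have "a \<otimes> d \<noteq> \<zero>" using mult_nonzero a a0 dc nonzero[OF dZ] by blast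
    ultimately show False using mult_right_cancel[of "a \<otimes> d" \<one> u] a dc uc u1 by simp
  qed
  have ur: "u [^] r = \<one>"
  proof -
    have "u [^] r = (l [^] r) [^] j" unfolding u_def using lc by (simp add: nat_pow_pow mult.commute)
    then show ?thesis using lr by simp
  qed
  show False
  \<comment> \<open>The power of \<open>u\<close> in \<open>(a d)^r\<close> has exponent
    \<open>r (r - 1) / 2\<close>. It is a multiple of \<open>r\<close> for odd \<open>r\<close>, but
    equals 1 for \<open>r = 2\<close>; then \<open>u = -1\<close> survives and
    \<open>w = a d\<close> is a square root of -1.\<close>
  proof (cases "r = 2")
    case False
    then have "odd r" using r r0 prime_odd_nat by auto
    then obtain k where k: "r = 2 * k + 1" by (auto elim: oddE)
    then have "r * (r - 1) div 2 = r * k" by simp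
    then have "u [^] (r * (r - 1) div 2) = (u [^] r) [^] k" using uc by (simp add: nat_pow_pow)
    then have "(a \<otimes> d) [^] r = \<one>"
      using twisted_mult_pow[OF uZ a(1) dc da, of r] ad_r ur by simp
    then have "a \<otimes> d \<in> Z" using roots_of_unity_central[OF r l(1) lr l(2)] a dc by simp
    then have "a \<otimes> (a \<otimes> d) = a \<otimes> (d \<otimes> a)"
      using center_commute[of "a \<otimes> d" a] a dc by (simp add: m_assoc)
    then show False using mult_left_cancel[of a "a \<otimes> d" "d \<otimes> a"] a a0 dc not_comm by simp
  next
    case True
    have two: "x [^] (2::nat) = x \<otimes> x" if "x \<in> carrier R" for x
      using that by (simp add: numeral_2_eq_2)
    have "(u \<oplus> \<ominus> \<one>) \<otimes> (u \<oplus> \<one>) = u \<otimes> u \<oplus> \<ominus> \<one>"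
      using uc by (simp add: l_distr r_distr l_minus a_ac r_neg r_neg1 r_neg2)
    also have "\<dots> = \<zero>" using ur True two uc by (simp add: r_neg)
    finally have "u \<oplus> \<ominus> \<one> = \<zero> \<or> u \<oplus> \<one> = \<zero>" using integral uc by simp
    moreover have "u \<oplus> \<ominus> \<one> \<noteq> \<zero>" using u1 uc by (metis minus_eq one_closed r_right_minus_eq)
    ultimately have u: "u = \<ominus> \<one>" using uc by (intro minus_equality[symmetric]) auto
    have da': "d \<otimes> a = \<ominus> (a \<otimes> d)" using da u a dc by (simp add: l_minus)
    show False
    proof (rule no_anticommuting_pair[OF a(1) a0])
      show "a \<otimes> a \<in> Z" using a(3) True two a by simp
      have "a \<otimes> d \<otimes> (a \<otimes> d) = a \<otimes> (d \<otimes> a) \<otimes> d" using a dc by (simp add: m_assoc)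
      also have "\<dots> = \<ominus> (a \<otimes> a \<otimes> (d \<otimes> d))" unfolding da' using a dc by (simp add: m_assoc l_minus r_minus)
      finally show "a \<otimes> d \<otimes> (a \<otimes> d) = \<ominus> \<one>" using ad_r True two a dc by simp
      show "a \<otimes> d \<otimes> a = \<ominus> (a \<otimes> (a \<otimes> d))" using da' a dc by (simp add: m_assoc r_minus)
      show "a \<otimes> (a \<otimes> d) \<noteq> a \<otimes> d \<otimes> a"
        using not_comm mult_left_cancel[of a "a \<otimes> d" "d \<otimes> a"] a a0 dc by (simp add: m_assoc)
    qed (use a dc in simp)
  qed
qed

text \<open>The least \<open>r > 0\<close> for which some noncentral \<open>a\<close> has central
  \<open>a^r\<close> is prime. An element \<open>b\<close> with \<open>b a = a^i b\<close> can be
  improved by Fermat's little theorem: \<open>c = b^(r-1)\<close> multiplies \<open>a\<close> by a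
  central factor \<open>l\<close>, and \<open>no_twisted_pair\<close> excludes such a pair.\<close>

lemma all_central: "x \<in> carrier R \<Longrightarrow> x \<in> Z"
proof (rule ccontr)
  assume x: "x \<in> carrier R" "x \<notin> Z"
  define P where "P r \<longleftrightarrow> r > 0 \<and> (\<exists>a\<in>carrier R - Z. a [^] r \<in> Z)" for r :: nat
  have nonzero: "y \<noteq> \<zero>" if "y \<notin> Z" for y using that subringE(2)[OF center_subring] by auto
  define q where "q = card (carrier R) - 1"
  have q: "y [^] q = \<one>" "q > 0" if "y \<in> carrier R" "y \<noteq> \<zero>" for y
    using pow_card_eq_one[OF finite_carrier that] by (auto simp: q_def)
  have q': "add_pow R q \<one> \<noteq> \<zero>"
  proof -
    have "add_pow R q \<one> = \<ominus> \<one>"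
      using pow_card_eq_one(2)[OF finite_carrier one_closed one_not_zero] by (simp add: q_def)
    then show ?thesis using one_not_zero by (metis add.inv_eq_1_iff one_closed)
  qed
  have "P q" unfolding P_def using x q[OF x(1) nonzero[OF x(2)]] subringE(3)[OF center_subring]
    by (metis DiffI)
  define r where "r = (LEAST r. P r)"
  have Pr: "P r" unfolding r_def by (rule LeastI[of P q, OF \<open>P q\<close>])
  have min: "y [^] k \<notin> Z" if "0 < k" "k < r" "y \<in> carrier R" "y \<notin> Z" for k :: nat and y
    using not_less_Least[of k P] that unfolding r_def P_def by blast
  obtain a where a: "a \<in> carrier R" "a \<notin> Z" "a [^] r \<in> Z" using Pr unfolding P_def by blast
  have r1: "r > 1"
  proof -
    have "r \<noteq> 1" using a by auto
    then show ?thesis using Pr by (auto simp: P_def)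
  qed
  have r: "Factorial_Ring.prime r"
    unfolding prime_nat_iff
  proof (intro conjI allI impI r1)
    fix u assume "u dvd r"
    then obtain v where v: "r = u * v" by blast
    show "u = 1 \<or> u = r"
    proof (rule ccontr)
      assume "\<not> (u = 1 \<or> u = r)"
      moreover have "u > 0" "v > 0" using v r1 by (auto intro: gr0I)
      moreover have "v \<noteq> 1" using calculation(1) v by auto
      ultimately have "0 < u" "u < r" "0 < v" "v < r" using v by (cases u; cases v; auto)+
      then have "(a [^] u) [^] v \<notin> Z" using min a by simp
      then show False using a v by (simp add: nat_pow_pow)
    qed
  qed
  obtain b i where b: "b \<in> carrier R" "b \<noteq> \<zero>" "b \<otimes> a = a [^] (i::nat) \<otimes> b" "a [^] i \<noteq> a"
  proof -
    obtain y where "y \<in> carrier R" "a \<otimes> y \<noteq> y \<otimes> a" using a centerI by blast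
    then show thesis
      using that exists_normalizing_element[OF a(1) q(1)[OF a(1) nonzero[OF a(2)]] q'] by blast
  qed
  have not_comm: "a \<otimes> b \<noteq> b \<otimes> a"
    using b a mult_right_cancel[of b a "a [^] i"] by auto
  have bZ: "b \<notin> Z" using not_comm center_commute[of b a] a by auto
  \<comment> \<open>Otherwise \<open>a^i\<close> would be a power of \<open>a^r\<close>, hence
    central, and cancelling \<open>b\<close> would give \<open>a^i = a\<close>.\<close>
  have ri: "\<not> r dvd i"
  proof
    assume "r dvd i"
    then obtain k where "i = r * k" by auto
    then have "a [^] i = (a [^] r) [^] k" using a by (simp add: nat_pow_pow)
    then have aiZ: "a [^] i \<in> Z" using center_pow a by simp
    then have "b \<otimes> a = b \<otimes> a [^] i" using b center_commute[OF aiZ b(1)] by simp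
    then show False using mult_left_cancel[of b a "a [^] i"] b a by auto
  qed
  \<comment> \<open>Writing \<open>i^(r-1) = k r + 1\<close>, conjugation by \<open>b^(r-1)\<close>
    sends \<open>a\<close> to \<open>(a^r)^k a\<close>, a central multiple of \<open>a\<close>. The
    exponent \<open>r - 1\<close> is below the minimal \<open>r\<close>, which keeps
    \<open>c\<close> noncentral.\<close>
  have "[i ^ (r - 1) = 1] (mod r)" using fermat_theorem[OF r ri] .
  moreover have "i ^ (r - 1) \<ge> 1"
    using ri by (cases i) auto
  ultimately obtain k where k: "i ^ (r - 1) = k * r + 1"
    by (metis cong_le_nat)
  define c where "c = b [^] (r - 1)"
  define l where "l = (a [^] r) [^] k"
  have c: "c \<in> carrier R" "c \<notin> Z" using b bZ min[of "r - 1" b] r1 by (auto simp: c_def)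
  have l: "l \<in> Z" unfolding l_def using a center_pow by blast
  have lc: "l \<in> carrier R" using l center_closed by blast
  have ca: "c \<otimes> a = l \<otimes> a \<otimes> c"
    using conj_pow_left[OF a(1) b(1,3), of "r - 1"] a
    unfolding k c_def l_def by (simp add: nat_pow_pow mult.commute)
  \<comment> \<open>If \<open>l\<close> were one, the noncentral \<open>c\<close> would commute with
    both \<open>a\<close> and \<open>b\<close>, which would then commute with each other.\<close>
  have l1: "l \<noteq> \<one>"
  proof
    assume "l = \<one>"
    then have "c \<otimes> a = a \<otimes> c" using ca a c by simp
    moreover have "c \<otimes> b = b \<otimes> c" unfolding c_def using b nat_pow_Suc2[of b "r - 1"] by simp
    ultimately show False using centralizer_commutative[OF c a(1) _ b(1)] not_comm by blast
  qed
  \<comment> \<open>The same principle: since \<open>l^r = 1\<close>, \<open>c^r\<close> commutes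
    with both \<open>a\<close> and \<open>c\<close>, which do not commute.\<close>
  have "c [^] r \<in> Z"
  proof (rule ccontr)
    assume n: "c [^] r \<notin> Z"
    have "l [^] r = \<one>"
      using twisted_root_of_unity[OF l a(1) c(1) ca _ _ a(3)] nonzero a c by simp
    then have "c [^] r \<otimes> a = a \<otimes> c [^] r" using twisted_pow[OF l a(1) c(1) ca, of r] a c by simp
    moreover have "c [^] r \<otimes> c = c \<otimes> c [^] r" using c nat_pow_Suc2[of c r] by simp
    ultimately have "a \<otimes> c = c \<otimes> a"
      using centralizer_commutative[OF _ n a(1) _ c(1)] c by simp
    then have "l \<otimes> (a \<otimes> c) = \<one> \<otimes> (a \<otimes> c)" using ca a c lc by (simp add: m_assoc)
    moreover have "a \<otimes> c \<noteq> \<zero>" using nonzero a c mult_nonzero by simp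
    ultimately show False using mult_right_cancel[of "a \<otimes> c" l \<one>] a c lc l1 by simp
  qed
  then show False using no_twisted_pair[OF r min a c(1,2) _ l l1 ca] by blast
qed

end

theorem finite_skew_field_commutative:
  assumes "skew_field R" "finite (carrier R)" "x \<in> carrier R" "y \<in> carrier R"
  shows "x \<otimes>\<^bsub>R\<^esub> y = y \<otimes>\<^bsub>R\<^esub> x"
  using assms
proof (induction "card (carrier R)" arbitrary: R x y rule: less_induct)
  case less
  interpret skew_field R by (rule less.prems(1))
  interpret minimal_finite_skew_field R
  proof
    fix S u v assume S: "subring S R" "S \<noteq> carrier R" "u \<in> S" "v \<in> S"
    have "S \<subset> carrier R" using subringE(1)[OF S(1)] S(2) by blast
    then have "card S < card (carrier R)" "finite S"
      using less.prems(2) psubset_card_mono finite_subset by blast+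
    then show "u \<otimes>\<^bsub>R\<^esub> v = v \<otimes>\<^bsub>R\<^esub> u"
      using less.hyps[of "R\<lparr>carrier := S\<rparr>" u v] finite_subring_skew_field[OF S(1)] S by simp
  qed (rule less.prems(2))
  show ?case using all_central[OF less.prems(3)] center_commute less.prems(4) by blast
qed

section \<open>Congruences modulo powers of a normalizing element\<close>

context skew_field
begin

text \<open>\<open>K\<close> is the prime subring with \<open>a\<close> adjoined, an extension with
  trivial twist; it contains \<open>inv a = a^(n-1)\<close>, so \<open>finite_S\<close> applies. An
  element carrying \<open>a\<close> to a power of \<open>a\<close> carries polynomials in
  \<open>a\<close> to polynomials in \<open>a\<close>; this last conclusion is the twist condition
  for adjoining \<open>y\<close> to \<open>K\<close>.\<close>

lemma torsion_finite_subring: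
  assumes N: "N > 0" "add_pow R (N::nat) \<one> = \<zero>"
    and a: "a \<in> carrier R" "a [^] (n::nat) = \<one>" "n > 0"
  obtains K where "subring K R" "finite K" "a \<in> K" "\<And>c. c \<in> K \<Longrightarrow> a \<otimes> c = c \<otimes> a"
    "\<And>y i c. y \<in> carrier R \<Longrightarrow> y \<otimes> a = a [^] (i::nat) \<otimes> y \<Longrightarrow> c \<in> K \<Longrightarrow> \<exists>c'\<in>K. y \<otimes> c = c' \<otimes> y"
proof -
  define B where "B = range (\<lambda>i::nat. add_pow R i \<one>)"
  have B: "subring B R" "finite B" unfolding B_def using prime_subring[OF N] by auto
  have B_central: "x \<otimes> c = c \<otimes> x" if "c \<in> B" "x \<in> carrier R" for c x
    using that add_pow_one_central by (auto simp: B_def)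
  have a0: "a \<noteq> \<zero>" using pow_eq_one_nonzero[OF a] .
  interpret A: skew_extension R B a
    by (intro skew_extension.intro skew_field_axioms skew_extension_axioms.intro)
      (use B a a0 B_central in blast)+
  let ?K = "skew_poly_ring R B a"
  note K = A.S_subring
  have pow_in: "a [^] (k::nat) \<in> ?K" for k
    by (induction k) (use K A.y_in_S in \<open>auto intro: subringE(3,6)\<close>)
  have "a [^] (n - 1) \<otimes> a = inv a \<otimes> a" using a a0 by (simp flip: nat_pow_Suc)
  then have "a [^] (n - 1) = inv a" using mult_right_cancel[of a "a [^] (n - 1)" "inv a"] a a0 by simp
  then have fin: "finite ?K" using A.finite_S[OF B(2)] pow_in by metis
  show thesis
  proof (rule that[OF K fin A.y_in_S])
    fix c assume "c \<in> ?K"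
    then show "a \<otimes> c = c \<otimes> a"
    proof (induction c rule: skew_poly_ring_induct)
      case (step c g)
      note car = A.B_carrier[OF step(1)] A.S_carrier[OF step(2)] a(1)
      have "a \<otimes> (c \<oplus> g \<otimes> a) = a \<otimes> c \<oplus> (a \<otimes> g) \<otimes> a"
        using car by (simp add: r_distr m_assoc)
      then show ?case unfolding B_central[OF step(1) a(1)] step(3) using car by (simp add: l_distr)
    qed (use a in simp)
  next
    fix y i c assume y: "y \<in> carrier R" "y \<otimes> a = a [^] (i::nat) \<otimes> y" and "c \<in> ?K"
    from this(3) show "\<exists>c'\<in>?K. y \<otimes> c = c' \<otimes> y"
    proof (induction c rule: skew_poly_ring_induct)
      case zero
      then show ?case using y skew_poly_ring_zero by (intro bexI[of _ \<zero>]) auto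
    next
      case (step c g)
      then obtain g' where g': "g' \<in> ?K" "y \<otimes> g = g' \<otimes> y" by blast
      have gc: "g' \<in> carrier R" "g \<in> carrier R" "c \<in> carrier R"
        using A.S_carrier A.B_carrier g' step by auto
      have "y \<otimes> (c \<oplus> g \<otimes> a) = c \<otimes> y \<oplus> (y \<otimes> g) \<otimes> a"
        using y(1) a(1) gc by (simp add: r_distr m_assoc B_central[OF step(1) y(1)])
      also have "\<dots> = c \<otimes> y \<oplus> g' \<otimes> (y \<otimes> a)" using g' y a gc by (simp add: m_assoc)
      also have "\<dots> = (c \<oplus> g' \<otimes> a [^] i) \<otimes> y" using y a gc by (simp add: l_distr m_assoc)
      finally show ?case
        using A.base_in_S[OF step(1)] pow_in[of i] g'(1) K by (blast intro: subringE(6,7))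
    qed
  qed
qed

text \<open>The exponent is \<open>card K - 1\<close> for a finite division ring \<open>K\<close>
  containing \<open>a\<close>, which is -1 in the ring.\<close>

lemma torsion_invertible_exponent:
  assumes N: "N > 0" "add_pow R (N::nat) \<one> = \<zero>"
    and a: "a \<in> carrier R" "a [^] (n::nat) = \<one>" "n > 0"
  obtains m :: nat where "a [^] m = \<one>" "add_pow R m \<one> \<noteq> \<zero>"
proof -
  obtain K where K: "subring K R" "finite K" "a \<in> K" using torsion_finite_subring[OF assms] by metis
  interpret K: skew_field "R\<lparr>carrier := K\<rparr>" by (rule finite_subring_skew_field[OF K(1,2)])
  have a0: "a \<noteq> \<zero>" using pow_eq_one_nonzero[OF a] .
  have pow: "add_pow (R\<lparr>carrier := K\<rparr>) m x = add_pow R m x" for m :: nat and x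
    by (simp add: add_pow_def nat_pow_def)
  have neg: "\<ominus>\<^bsub>R\<lparr>carrier := K\<rparr>\<^esub> \<one> \<noteq> \<zero>"
    using K.add.inv_eq_1_iff[of \<one>] K.one_closed one_not_zero by simp
  show thesis
    by (rule that[of "card K - 1"])
      (use K.pow_card_eq_one(1,2)[of a] K a0 neg in \<open>simp_all add: pow flip: nat_pow_consistent\<close>)
qed

end

section \<open>Polynomials in a normalizing element over a finite subring\<close>

locale normalized_extension = skew_extension R K y for R (structure) and K y +
  fixes a and i :: nat
  assumes finite_K: "finite K"
    and a: "a \<in> K" and a_commute: "c \<in> K \<Longrightarrow> a \<otimes> c = c \<otimes> a"
    and ya: "y \<otimes> a = a [^] i \<otimes> y" and moved: "a [^] i \<noteq> a"
begin

lemma a_carrier: "a \<in> carrier R"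
  using a B_carrier by blast

lemma not_commute: "y \<otimes> a \<noteq> a \<otimes> y"
  using ya moved mult_right_cancel[of y "a [^] i" a] a_carrier y by auto

lemma a_nonzero: "a \<noteq> \<zero>"
  using not_commute y by auto

lemma K_inv: "c \<in> K \<Longrightarrow> c \<noteq> \<zero> \<Longrightarrow> inv c \<in> K"
  using finite_subring_inv[OF B finite_K] by blast

text \<open>Wedderburn's theorem enters here: with \<open>inv y\<close> in it, \<open>S\<close>
  would be a finite division ring, hence commutative, yet it contains \<open>a\<close> and
  \<open>y\<close>.\<close>

lemma inv_y_notin: "inv y \<notin> S"
proof
  assume "inv y \<in> S"
  then have fin: "finite S" using finite_S finite_K by blast
  have "y \<otimes> a = a \<otimes> y"
    using finite_skew_field_commutative[OF finite_subring_skew_field[OF S_subring fin], of y a]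
      fin y_in_S base_in_S[OF a] by simp
  then show False using not_commute by blast
qed

text \<open>The substitute for uniqueness of coefficients: an equality would give
  \<open>inv y = (inv d) h\<close>, an element of \<open>S\<close>.\<close>

lemma constant_not_multiple:
  assumes d: "d \<in> K" "d \<noteq> \<zero>" and h: "h \<in> S"
  shows "d \<noteq> h \<otimes> y"
proof
  assume "d = h \<otimes> y"
  moreover have "inv d \<otimes> d \<otimes> inv y = inv y" using d y B_carrier by simp
  ultimately have "inv d \<otimes> (h \<otimes> y) \<otimes> inv y = inv y" by metis
  then have "inv d \<otimes> h = inv y" using d y h B_carrier S_carrier by (simp add: m_assoc)
  then show False using S_scale[OF K_inv[OF d] h] inv_y_notin by simp
qed

text \<open>Extends the twist from coefficients to all of \<open>S\<close>, so that the left ideal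
  \<open>S y^2\<close> is also closed under right multiplication by \<open>S\<close>.\<close>

lemma S_twist: "s \<in> S \<Longrightarrow> \<exists>s'\<in>S. y \<otimes> s = s' \<otimes> y"
proof (induction s rule: skew_poly_ring_induct)
  case zero
  then show ?case using y skew_poly_ring_zero by (intro bexI[of _ \<zero>]) auto
next
  case (step c g)
  obtain g' where g': "g' \<in> S" "y \<otimes> g = g' \<otimes> y" using step by blast
  obtain c' where c': "c' \<in> K" "y \<otimes> c = c' \<otimes> y" using twist step by blast
  have "y \<otimes> (c \<oplus> g \<otimes> y) = y \<otimes> c \<oplus> (y \<otimes> g) \<otimes> y"
    using y step B_carrier S_carrier by (simp add: r_distr m_assoc)
  also have "\<dots> = (c' \<oplus> g' \<otimes> y) \<otimes> y"
    unfolding g' c' using y g' c' B_carrier S_carrier by (simp add: l_distr)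
  finally show ?case
    by (rule bexI[of _ "c' \<oplus> g' \<otimes> y"]) (intro skew_poly_ring_step c'(1) g'(1))
qed

section \<open>The ideal of multiples of \<open>y^2\<close>, and first-order coefficients\<close>

definition J where "J = {g \<otimes> y \<otimes> y | g. g \<in> S}"

lemma J_S: "j \<in> J \<Longrightarrow> j \<in> S"
  unfolding J_def using S_mult_y by auto

lemma J_carrier: "j \<in> J \<Longrightarrow> j \<in> carrier R"
  using J_S S_carrier by blast

lemma J_zero: "\<zero> \<in> J"
  unfolding J_def using skew_poly_ring_zero y by force

lemma J_add: "j \<in> J \<Longrightarrow> k \<in> J \<Longrightarrow> j \<oplus> k \<in> J"
proof -
  assume "j \<in> J" "k \<in> J"
  then obtain g h where "g \<in> S" "h \<in> S" "j = g \<otimes> y \<otimes> y" "k = h \<otimes> y \<otimes> y" by (auto simp: J_def)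
  then have "j \<oplus> k = (g \<oplus> h) \<otimes> y \<otimes> y" "g \<oplus> h \<in> S"
    using S_carrier y S_add by (auto simp: l_distr)
  then show ?thesis unfolding J_def by blast
qed

lemma J_mult_left: "s \<in> S \<Longrightarrow> j \<in> J \<Longrightarrow> s \<otimes> j \<in> J"
proof -
  assume s: "s \<in> S" and "j \<in> J"
  then obtain g where "g \<in> S" "j = g \<otimes> y \<otimes> y" by (auto simp: J_def)
  then have "s \<otimes> j = (s \<otimes> g) \<otimes> y \<otimes> y" "s \<otimes> g \<in> S"
    using s S_carrier y S_mult by (auto simp: m_assoc)
  then show ?thesis unfolding J_def by blast
qed

lemma J_mult_right: "s \<in> S \<Longrightarrow> j \<in> J \<Longrightarrow> j \<otimes> s \<in> J"
proof -
  assume s: "s \<in> S" and "j \<in> J"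
  then obtain g where g: "g \<in> S" "j = g \<otimes> y \<otimes> y" by (auto simp: J_def)
  obtain s' where s': "s' \<in> S" "y \<otimes> s = s' \<otimes> y" using S_twist s by blast
  obtain s'' where s'': "s'' \<in> S" "y \<otimes> s' = s'' \<otimes> y" using S_twist s' by blast
  note c = s[THEN S_carrier] g(1)[THEN S_carrier] s'(1)[THEN S_carrier] s''(1)[THEN S_carrier] y(1)
  have "j \<otimes> s = g \<otimes> (y \<otimes> (y \<otimes> s))" using g c by (simp add: m_assoc)
  also have "\<dots> = g \<otimes> ((y \<otimes> s') \<otimes> y)" unfolding s' using c by (simp add: m_assoc)
  also have "\<dots> = (g \<otimes> s'') \<otimes> y \<otimes> y" unfolding s'' using c by (simp add: m_assoc)
  finally show ?thesis unfolding J_def using S_mult[OF g(1) s''(1)] by blast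
qed

lemma J_uminus: "j \<in> J \<Longrightarrow> \<ominus> j \<in> J"
proof -
  assume j: "j \<in> J"
  have "\<ominus> \<one> \<in> S" using subringE(3,5)[OF S_subring] by blast
  then have "\<ominus> \<one> \<otimes> j \<in> J" using J_mult_left j by blast
  then show ?thesis using J_carrier[OF j] by (simp add: l_minus)
qed

text \<open>\<open>P c f\<close> means that \<open>f\<close> is congruent to \<open>1 + c y\<close> modulo \<open>y\<^sup>2\<close>.\<close>

definition P where "P c f \<longleftrightarrow> c \<in> K \<and> (\<exists>j\<in>J. f = \<one> \<oplus> c \<otimes> y \<oplus> j)"

lemma P_I: "c \<in> K \<Longrightarrow> j \<in> J \<Longrightarrow> f = \<one> \<oplus> c \<otimes> y \<oplus> j \<Longrightarrow> P c f"
  unfolding P_def by blast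

lemma P_S: "P c f \<Longrightarrow> f \<in> S"
  unfolding P_def by (auto simp: S_add S_mult_y base_in_S J_S subringE(3)[OF B])

lemma P_carrier: "P c f \<Longrightarrow> f \<in> carrier R"
  using P_S S_carrier by blast

text \<open>Linear coefficients add, because \<open>y d = d' y\<close> puts the cross term
  \<open>c (y d) y\<close> into \<open>J\<close>.\<close>

lemma P_mult:
  assumes "P c f" "P d g"
  shows "P (c \<oplus> d) (f \<otimes> g)"
proof -
  obtain j k where cK: "c \<in> K" and j: "j \<in> J" "f = \<one> \<oplus> c \<otimes> y \<oplus> j"
    and dK: "d \<in> K" and k: "k \<in> J" "g = \<one> \<oplus> d \<otimes> y \<oplus> k"
    using assms by (auto simp: P_def)
  note car = B_carrier[OF cK] B_carrier[OF dK] J_carrier[OF j(1)] J_carrier[OF k(1)] y(1)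
  obtain d' where d': "d' \<in> K" "y \<otimes> d = d' \<otimes> y" using twist dK by blast
  have "f \<otimes> g = \<one> \<oplus> (c \<oplus> d) \<otimes> y \<oplus> (c \<otimes> (y \<otimes> d) \<otimes> y \<oplus> k \<oplus> c \<otimes> y \<otimes> k \<oplus> j \<otimes> g)"
  proof -
    have "f \<otimes> g = (\<one> \<oplus> c \<otimes> y) \<otimes> (\<one> \<oplus> d \<otimes> y \<oplus> k) \<oplus> j \<otimes> g"
      unfolding j(2) k(2) using car by (simp add: l_distr)
    also have "(\<one> \<oplus> c \<otimes> y) \<otimes> (\<one> \<oplus> d \<otimes> y \<oplus> k)
        = \<one> \<oplus> (c \<oplus> d) \<otimes> y \<oplus> (c \<otimes> (y \<otimes> d) \<otimes> y \<oplus> k \<oplus> c \<otimes> y \<otimes> k)"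
      using car by (simp add: l_distr r_distr m_assoc a_ac)
    finally show ?thesis using car P_carrier[OF assms(2)] by (simp add: a_assoc)
  qed
  moreover have "c \<otimes> (y \<otimes> d) \<otimes> y \<in> J"
  proof -
    have "c \<otimes> (y \<otimes> d) \<otimes> y = (c \<otimes> d') \<otimes> y \<otimes> y"
      unfolding d' using car B_carrier[OF d'(1)] by (simp add: m_assoc)
    moreover have "c \<otimes> d' \<in> S" using S_scale cK base_in_S d' by blast
    ultimately show ?thesis unfolding J_def by blast
  qed
  moreover have "c \<otimes> y \<otimes> k \<in> J" "j \<otimes> g \<in> J"
    using J_mult_left J_mult_right S_mult_y base_in_S cK k j P_S[OF assms(2)] by auto
  ultimately show ?thesis
    using k J_add subringE(7)[OF B] cK dK by (intro P_I[of "c \<oplus> d"]) auto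
qed

text \<open>The eigenvalue of conjugation by \<open>a\<close> on \<open>y\<close>; see
  \<open>conj_y\<close>.\<close>

definition e where "e = a \<otimes> inv (a [^] i)"

lemma a_pow_K: "a [^] (k::nat) \<in> K"
  by (induction k) (use B a in \<open>auto intro: subringE(3,6)\<close>)

lemma a_pow_inv: "inv (a [^] i) \<in> K" "a [^] i \<noteq> \<zero>"
  using K_inv a_pow_K pow_nonzero a_carrier a_nonzero by auto

lemma e_K: "e \<in> K"
  unfolding e_def using a a_pow_inv subringE(6)[OF B] by blast

lemma e_neq_one: "e \<noteq> \<one>"
proof
  assume "e = \<one>"
  then have "a \<otimes> inv (a [^] i) \<otimes> a [^] i = a [^] i" unfolding e_def using a_carrier by simp
  then have "a = a [^] i" using a_carrier a_pow_inv B_carrier by (simp add: m_assoc)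
  then show False using moved by simp
qed

lemma conj_y: "a \<otimes> y \<otimes> inv a = e \<otimes> y"
proof -
  have "a [^] i \<otimes> (y \<otimes> inv a) = (y \<otimes> a) \<otimes> inv a"
    unfolding ya using a_carrier a_nonzero y by (simp add: m_assoc)
  also have "\<dots> = y" using a_carrier a_nonzero y by (simp add: m_assoc)
  finally have "y \<otimes> inv a = inv (a [^] i) \<otimes> y"
    using a_carrier a_nonzero y a_pow_inv
    by (metis inv_nonzero(1,3) l_one m_assoc m_closed nat_pow_closed)
  then show ?thesis unfolding e_def using a_carrier a_nonzero y a_pow_inv B_carrier by (simp add: m_assoc)
qed

text \<open>Since \<open>a\<close> commutes with the coefficients in \<open>K\<close>, only
  \<open>y\<close> is scaled.\<close>

lemma P_conj:
  assumes "P c f"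
  shows "P (c \<otimes> e) (a \<otimes> f \<otimes> inv a)"
proof -
  obtain j where cK: "c \<in> K" and j: "j \<in> J" "f = \<one> \<oplus> c \<otimes> y \<oplus> j"
    using assms by (auto simp: P_def)
  have ia: "inv a \<in> carrier R" "inv a \<in> K" "a \<otimes> inv a = \<one>"
    using a_carrier a_nonzero K_inv a by auto
  note car = B_carrier[OF cK] J_carrier[OF j(1)] y(1) ia(1) a_carrier B_carrier[OF e_K]
  have "a \<otimes> f \<otimes> inv a = a \<otimes> inv a \<oplus> (a \<otimes> c) \<otimes> y \<otimes> inv a \<oplus> a \<otimes> j \<otimes> inv a"
    unfolding j(2) using car by (simp add: l_distr r_distr m_assoc del: inv_nonzero)
  also have "(a \<otimes> c) \<otimes> y \<otimes> inv a = c \<otimes> (a \<otimes> y \<otimes> inv a)"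
    unfolding a_commute[OF cK] using car by (simp add: m_assoc)
  also have "\<dots> = c \<otimes> e \<otimes> y" unfolding conj_y using car by (simp add: m_assoc)
  finally have "a \<otimes> f \<otimes> inv a = \<one> \<oplus> c \<otimes> e \<otimes> y \<oplus> a \<otimes> j \<otimes> inv a" using ia by simp
  moreover have "a \<otimes> j \<otimes> inv a \<in> J"
    using J_mult_left J_mult_right j base_in_S a ia by simp
  ultimately show ?thesis using subringE(6)[OF B] cK e_K by (intro P_I) auto
qed

lemma P_one: "P \<zero> \<one>"
  by (rule P_I[OF _ J_zero]) (use subringE(2)[OF B] y in auto)

text \<open>Two such expansions differ by \<open>d y\<close> in \<open>S y^2\<close>; cancelling
  \<open>y\<close> makes the constant \<open>d\<close> a multiple of \<open>y\<close>.\<close>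

lemma P_unique_zero:
  assumes "P \<zero> f" "P d f"
  shows "d = \<zero>"
proof (rule ccontr)
  assume d0: "d \<noteq> \<zero>"
  obtain j k where j: "j \<in> J" "f = \<one> \<oplus> \<zero> \<otimes> y \<oplus> j"
    and dK: "d \<in> K" and k: "k \<in> J" "f = \<one> \<oplus> d \<otimes> y \<oplus> k"
    using assms by (auto simp: P_def)
  note car = B_carrier[OF dK] J_carrier[OF j(1)] J_carrier[OF k(1)] y(1)
  have "\<one> \<oplus> (d \<otimes> y \<oplus> k) = \<one> \<oplus> j" using j k car by (simp add: a_assoc)
  then have "d \<otimes> y \<oplus> k = j" using car by simp
  then have "d \<otimes> y = j \<oplus> \<ominus> k" using car by (metis a_assoc a_inv_closed m_closed r_neg r_zero)
  moreover have "j \<oplus> \<ominus> k \<in> J" using J_add J_uminus j k by blast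
  then obtain g where g: "g \<in> S" "j \<oplus> \<ominus> k = g \<otimes> y \<otimes> y" unfolding J_def by blast
  ultimately have "d = g \<otimes> y"
    using mult_right_cancel[of y d "g \<otimes> y"] y car S_carrier[OF g(1)] by simp
  then show False using constant_not_multiple[OF dK d0 g(1)] by blast
qed

end

section \<open>Denominators, and first-order coefficients beyond polynomials\<close>

context normalized_extension
begin

text \<open>With this sign \<open>1 + y\<close> becomes \<open>1 - u\<close>, which divides every
  \<open>1 - u^k\<close> by the geometric series.\<close>

definition u where "u = \<ominus> y"

lemma u: "u \<in> carrier R" "u \<noteq> \<zero>" "u \<otimes> a = a [^] i \<otimes> u" "u \<in> S" "y \<oplus> u = \<zero>"
proof -
  show "u \<in> carrier R" "y \<oplus> u = \<zero>" unfolding u_def using y by (auto simp: r_neg)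
  show "u \<noteq> \<zero>" unfolding u_def using y by (metis minus_minus minus_zero)
  show "u \<otimes> a = a [^] i \<otimes> u"
    unfolding u_def using y a_carrier ya by (simp add: l_minus r_minus)
  show "u \<in> S" unfolding u_def using y_in_S subringE(5)[OF S_subring] by blast
qed

lemma u_pow_J: "m \<ge> 2 \<Longrightarrow> u [^] (m::nat) \<in> J"
proof (induction m rule: dec_induct)
  case base
  have "u [^] (2::nat) = \<one> \<otimes> y \<otimes> y"
    unfolding u_def using y by (simp add: numeral_2_eq_2 l_minus r_minus)
  then show ?case unfolding J_def using base_in_S subringE(3)[OF B] by blast
next
  case (step m)
  then show ?case using J_mult_right u by simp
qed

text \<open>Moving \<open>u^k\<close> past \<open>a\<close> yields \<open>a^(i^k)\<close>, an
  element of the finite \<open>K\<close>; two equal values give a power of \<open>u\<close>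
  commuting with \<open>a\<close>. Exponent one is excluded because \<open>a^i\<close> differs from
  \<open>a\<close>, and exponents from two on are the ones with \<open>u^m\<close> in
  \<open>J\<close>.\<close>

lemma exists_commuting_power: "\<exists>m\<ge>2. a \<otimes> u [^] (m::nat) = u [^] m \<otimes> a"
proof -
  define A where "A k = a [^] (i ^ k)" for k :: nat
  have A: "u [^] k \<otimes> a = A k \<otimes> u [^] k" "A k \<in> carrier R" for k
    unfolding A_def using conj_pow_left[OF a_carrier u(1,3)] a_carrier by auto
  have "range A \<subseteq> K" using a_pow_K by (auto simp: A_def)
  then have "finite (range A)" using finite_subset finite_K by metis
  then have "\<not> inj A" using finite_imageD infinite_UNIV_nat by blast
  then obtain k l where kl: "A k = A l" "k < l"
    unfolding inj_def by (metis linorder_neqE_nat)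
  define m where "m = l - k"
  have m: "l = k + m" using kl by (simp add: m_def)
  have uk: "u [^] k \<in> carrier R" "u [^] k \<noteq> \<zero>" using u pow_nonzero by auto
  have "u [^] k \<otimes> (u [^] m \<otimes> a) = u [^] l \<otimes> a"
    unfolding m using u a_carrier by (simp flip: nat_pow_mult add: m_assoc)
  also have "\<dots> = (A k \<otimes> u [^] k) \<otimes> u [^] m"
    unfolding A(1) m using kl m A(2) u by (simp flip: nat_pow_mult add: m_assoc)
  also have "\<dots> = u [^] k \<otimes> (a \<otimes> u [^] m)"
    using u a_carrier by (simp flip: A(1) add: m_assoc)
  finally have comm: "u [^] m \<otimes> a = a \<otimes> u [^] m"
    using mult_left_cancel[OF uk] u a_carrier by simp
  have "m \<noteq> 1"
    using comm u(1-3) moved mult_right_cancel[of u "a [^] i" a] a_carrier by auto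
  moreover have "m \<noteq> 0" using kl by (simp add: m_def)
  ultimately show ?thesis using comm by (intro exI[of _ m]) auto
qed

definition m where "m = (SOME m. m \<ge> 2 \<and> a \<otimes> u [^] (m::nat) = u [^] m \<otimes> a)"

lemma m: "m \<ge> 2" "a \<otimes> u [^] m = u [^] m \<otimes> a"
  using someI_ex[OF exists_commuting_power] unfolding m_def by auto

text \<open>Congruent to one modulo \<open>y^2\<close>, so multiplying by its powers leaves linear
  coefficients unchanged.\<close>

definition z where "z = \<one> \<oplus> \<ominus> (u [^] m)"

lemma P_z: "P \<zero> z"
  by (rule P_I[OF _ J_uminus[OF u_pow_J[OF m(1)]]])
    (use subringE(2)[OF B] y u in \<open>auto simp: z_def\<close>)

lemma z: "z \<in> carrier R" "z \<noteq> \<zero>" "a \<otimes> z = z \<otimes> a" "y \<otimes> z = z \<otimes> y"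
proof -
  show "z \<in> carrier R" using u by (simp add: z_def)
  show "a \<otimes> z = z \<otimes> a"
    unfolding z_def using u a_carrier m by (simp add: l_distr r_distr l_minus r_minus)
  have "u \<otimes> u [^] m = u [^] m \<otimes> u" using nat_pow_Suc2[OF u(1), of m] by simp
  then have "\<ominus> u \<otimes> u [^] m = u [^] m \<otimes> \<ominus> u"
    using u(1) by (simp add: l_minus r_minus del: nat_pow_Suc)
  moreover have "\<ominus> u = y" unfolding u_def using y by simp
  ultimately have "y \<otimes> u [^] m = u [^] m \<otimes> y" by simp
  then show "y \<otimes> z = z \<otimes> y"
    unfolding z_def using u y by (simp add: l_distr r_distr l_minus r_minus)
  show "z \<noteq> \<zero>"
  proof
    assume "z = \<zero>"
    then have "u [^] m = \<one>" using u unfolding z_def by (metis minus_eq nat_pow_closed one_closed r_right_minus_eq)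
    moreover obtain g where "g \<in> S" "u [^] m = g \<otimes> y \<otimes> y"
      using u_pow_J[OF m(1)] unfolding J_def by blast
    ultimately show False
      using constant_not_multiple[of \<one> "g \<otimes> y"] S_mult_y subringE(3)[OF B] one_not_zero by simp
  qed
qed

definition b where "b = \<one> \<oplus> y"

lemma b: "b \<in> carrier R" "b \<noteq> \<zero>" "b \<otimes> z = z \<otimes> b" "P \<one> b"
proof -
  show "b \<in> carrier R" using y by (simp add: b_def)
  show "b \<otimes> z = z \<otimes> b" using y z by (simp add: b_def l_distr r_distr)
  show "P \<one> b" by (rule P_I[OF _ J_zero]) (use subringE(3)[OF B] y in \<open>auto simp: b_def\<close>)
  show "b \<noteq> \<zero>"
  proof
    assume "b = \<zero>"
    then have "\<one> = \<ominus> y" using y unfolding b_def by (intro minus_equality[symmetric]) auto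
    then have "y = \<ominus> \<one>" using y by simp
    then show False using not_commute a_carrier by (simp add: l_minus r_minus)
  qed
qed

text \<open>\<open>inv b\<close> times \<open>z\<close> is the truncated geometric series
  \<open>1 + u + ... + u^(m-1)\<close>, built up by induction; its linear term is
  \<open>u = -y\<close>.\<close>

lemma P_inv_b: "P (\<ominus> \<one>) (inv b \<otimes> z)"
proof -
  have "\<exists>s. P (\<ominus> \<one>) s \<and> b \<otimes> s = \<one> \<oplus> \<ominus> (u [^] k)" if "k \<ge> 2" for k :: nat
    using that
  proof (induction k rule: dec_induct)
    case base
    have "P (\<ominus> \<one>) (\<one> \<oplus> u)"
      by (rule P_I[OF _ J_zero]) (use subringE(3,5)[OF B] y u in \<open>auto simp: u_def l_minus\<close>)
    moreover have "b \<otimes> (\<one> \<oplus> u) = \<one> \<oplus> \<ominus> (u [^] (2::nat))"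
      unfolding b_def u_def using y
      by (simp add: numeral_2_eq_2 l_distr r_distr l_minus r_minus a_assoc minus_add r_neg1 r_neg2)
    ultimately show ?case by blast
  next
    case (step k)
    then obtain s where s: "P (\<ominus> \<one>) s" "b \<otimes> s = \<one> \<oplus> \<ominus> (u [^] k)" by blast
    have "P (\<ominus> \<one>) (s \<oplus> u [^] k)"
    proof -
      obtain j where "\<ominus> \<one> \<in> K" "j \<in> J" "s = \<one> \<oplus> \<ominus> \<one> \<otimes> y \<oplus> j"
        using s by (auto simp: P_def)
      then show ?thesis
        by (intro P_I[OF _ J_add[of j "u [^] k"]]) (use u_pow_J step y u J_carrier in \<open>auto simp: a_assoc\<close>)
    qed
    moreover have "b \<otimes> (s \<oplus> u [^] k) = \<one> \<oplus> \<ominus> (u [^] Suc k)"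
    proof -
      have "b \<otimes> (s \<oplus> u [^] k) = \<one> \<oplus> \<ominus> (u [^] k) \<oplus> b \<otimes> u [^] k"
        using b P_carrier[OF s(1)] u s(2) by (simp add: r_distr)
      also have "b \<otimes> u [^] k = u [^] k \<oplus> \<ominus> (u \<otimes> u [^] k)"
        unfolding b_def u_def using y by (simp add: l_distr l_minus)
      also have "u \<otimes> u [^] k = u [^] Suc k" using nat_pow_Suc2[OF u(1)] by metis
      finally show ?thesis using u by (simp add: a_assoc r_neg1 r_neg2 del: nat_pow_Suc)
    qed
    ultimately show ?case by blast
  qed
  then obtain s where s: "P (\<ominus> \<one>) s" "b \<otimes> s = z" using m(1) unfolding z_def by blast
  have "inv b \<otimes> z = s" using b P_carrier[OF s(1)] by (simp flip: s(2) m_assoc)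
  then show ?thesis using s by simp
qed

text \<open>
  The element \<open>z\<close> commutes with \<open>a\<close> and \<open>y\<close> and is a multiple of \<open>b = 1 + y\<close> in \<open>K[y]\<close>, so every
  element of the group generated by \<open>a\<close> and \<open>b\<close> has some power of \<open>z\<close> as denominator. This extends
  the first-order coefficient from polynomials to that group without localizing \<open>K[y]\<close>.
\<close>

definition Q where
  "Q c v \<longleftrightarrow> v \<in> carrier R \<and> v \<noteq> \<zero> \<and> v \<otimes> z = z \<otimes> v \<and>
     (\<exists>k::nat. P c (v \<otimes> z [^] k) \<and> P (\<ominus> c) (inv v \<otimes> z [^] k))"

lemma Q_K: "Q c v \<Longrightarrow> c \<in> K"
  by (auto simp: Q_def P_def)

lemma Q_b: "Q \<one> b"
proof -
  have "P (\<one> \<oplus> \<zero>) (b \<otimes> z)" using P_mult b P_z by blast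
  then show ?thesis unfolding Q_def using b P_inv_b z by (auto intro!: exI[of _ 1])
qed

lemma inv_mult:
  assumes "v \<in> carrier R" "v \<noteq> \<zero>" "w \<in> carrier R" "w \<noteq> \<zero>"
  shows "inv (v \<otimes> w) = inv w \<otimes> inv v"
proof -
  have "v \<otimes> w \<otimes> inv (v \<otimes> w) = \<one>" using assms mult_nonzero by simp
  moreover have "v \<otimes> w \<otimes> (inv w \<otimes> inv v) = v \<otimes> (w \<otimes> inv w) \<otimes> inv v"
    using assms by (simp add: m_assoc del: inv_nonzero(3,4))
  then have "v \<otimes> w \<otimes> (inv w \<otimes> inv v) = \<one>" using assms by simp
  ultimately show ?thesis
    using mult_left_cancel[of "v \<otimes> w" "inv (v \<otimes> w)" "inv w \<otimes> inv v"] assms mult_nonzero by simp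
qed

lemma inv_inv:
  assumes "v \<in> carrier R" "v \<noteq> \<zero>"
  shows "inv (inv v) = v"
  using assms Units_inv_inv[of v] by (simp add: Units_iff)

lemma Q_mult:
  assumes "Q c v" "Q d w"
  shows "Q (c \<oplus> d) (v \<otimes> w)"
proof -
  obtain k l :: nat where v: "v \<in> carrier R" "v \<noteq> \<zero>" "v \<otimes> z = z \<otimes> v"
    and k: "P c (v \<otimes> z [^] k)" "P (\<ominus> c) (inv v \<otimes> z [^] k)"
    and w: "w \<in> carrier R" "w \<noteq> \<zero>" "w \<otimes> z = z \<otimes> w"
    and l: "P d (w \<otimes> z [^] l)" "P (\<ominus> d) (inv w \<otimes> z [^] l)"
    using assms by (auto simp: Q_def)
  have cd: "c \<in> carrier R" "d \<in> carrier R" using Q_K assms B_carrier by auto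
  \<comment> \<open>Denominators multiply because the powers of \<open>z\<close> can be moved past
    \<open>q\<close>.\<close>
  have swap: "(p \<otimes> q) \<otimes> z [^] (j + j') = (p \<otimes> z [^] j) \<otimes> (q \<otimes> z [^] j')"
    if "p \<in> carrier R" "q \<in> carrier R" "q \<otimes> z = z \<otimes> q" for p q and j j' :: nat
  proof -
    have "z [^] j \<otimes> q = q \<otimes> z [^] j" using that z by (intro group_commutes_pow) auto
    then have "(p \<otimes> z [^] j) \<otimes> (q \<otimes> z [^] j') = p \<otimes> (q \<otimes> z [^] j) \<otimes> z [^] j'"
      using that z by (simp add: m_assoc flip: \<open>z [^] j \<otimes> q = _\<close>)
    then show ?thesis using that z by (simp add: m_assoc nat_pow_mult)
  qed
  have "P (c \<oplus> d) ((v \<otimes> w) \<otimes> z [^] (k + l))"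
    unfolding swap[OF v(1) w(1,3)] using P_mult k l by blast
  moreover have "P (\<ominus> d \<oplus> \<ominus> c) ((inv w \<otimes> inv v) \<otimes> z [^] (l + k))"
    using swap[of "inv w" "inv v" l k] commute_inv[OF v(1,2) z(1) v(3)] P_mult k l v w by simp
  moreover have "\<ominus> d \<oplus> \<ominus> c = \<ominus> (c \<oplus> d)" using cd by (simp add: minus_add a_comm)
  moreover have "v \<otimes> w \<otimes> z = z \<otimes> (v \<otimes> w)"
    using v w z by (simp add: m_assoc) (simp flip: m_assoc)
  ultimately show ?thesis
    unfolding Q_def using v w mult_nonzero by (auto simp: inv_mult add.commute intro!: exI[of _ "k + l"])
qed

text \<open>Immediate, since \<open>Q\<close> records the expansions of an element and of its
  inverse together.\<close>

lemma Q_inv: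
  assumes "Q c v"
  shows "Q (\<ominus> c) (inv v)"
proof -
  have "c \<in> carrier R" using Q_K assms B_carrier by auto
  then show ?thesis using assms commute_inv[of v z] z by (auto simp: Q_def inv_inv)
qed

lemma Q_conj:
  assumes "Q c v"
  shows "Q (c \<otimes> e) (a \<otimes> v \<otimes> inv a)"
proof -
  obtain k :: nat where v: "v \<in> carrier R" "v \<noteq> \<zero>" "v \<otimes> z = z \<otimes> v"
    and k: "P c (v \<otimes> z [^] k)" "P (\<ominus> c) (inv v \<otimes> z [^] k)"
    using assms by (auto simp: Q_def)
  have c: "c \<in> carrier R" "e \<in> carrier R" using Q_K assms B_carrier e_K by auto
  note a' = a_carrier a_nonzero
  have zia: "inv a \<otimes> z [^] j = z [^] j \<otimes> inv a" for j :: nat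
    using group_commutes_pow[of z a j] commute_inv[of a "z [^] j"] z a' by simp
  have swap: "a \<otimes> p \<otimes> inv a \<otimes> z [^] j = a \<otimes> (p \<otimes> z [^] j) \<otimes> inv a"
    if "p \<in> carrier R" for p and j :: nat
    using that a' z by (simp add: m_assoc zia)
  have "P (c \<otimes> e) (a \<otimes> v \<otimes> inv a \<otimes> z [^] k)"
    unfolding swap[OF v(1)] by (rule P_conj[OF k(1)])
  moreover have "inv (a \<otimes> v \<otimes> inv a) = a \<otimes> inv v \<otimes> inv a"
    using v a' by (simp add: inv_mult mult_nonzero inv_inv m_assoc)
  moreover have "P (\<ominus> (c \<otimes> e)) (a \<otimes> inv v \<otimes> inv a \<otimes> z [^] k)"
    using P_conj[OF k(2)] swap[of "inv v" k] v c by (simp add: l_minus)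
  moreover have "a \<otimes> v \<otimes> inv a \<otimes> z = z \<otimes> (a \<otimes> v \<otimes> inv a)"
  proof -
    have "a \<otimes> v \<otimes> inv a \<otimes> z = a \<otimes> (v \<otimes> z) \<otimes> inv a"
      using zia[of 1] v(1) a' z(1) by (simp add: m_assoc)
    also have "\<dots> = (a \<otimes> z) \<otimes> v \<otimes> inv a" unfolding v(3) using v(1) a' z(1) by (simp add: m_assoc)
    also have "\<dots> = z \<otimes> (a \<otimes> v \<otimes> inv a)" unfolding z(3) using v(1) a' z(1) by (simp add: m_assoc)
    finally show ?thesis .
  qed
  ultimately show ?thesis unfolding Q_def using v a' mult_nonzero by auto
qed

lemma Q_one: "Q \<zero> \<one>"
  unfolding Q_def using z P_one one_not_zero by (auto intro!: exI[of _ "0::nat"])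

lemma Q_pow: "Q c v \<Longrightarrow> Q (add_pow R n c) (v [^] (n::nat))"
proof (induction n)
  case (Suc n)
  then show ?case using Q_mult by simp
qed (simp add: Q_one)

text \<open>Clearing the denominator leaves a power of \<open>z\<close>, whose linear coefficient is
  zero.\<close>

lemma Q_one_unique:
  assumes "Q d \<one>"
  shows "d = \<zero>"
proof -
  obtain k :: nat where k: "P d (z [^] k)" using assms z by (auto simp: Q_def)
  have "P \<zero> (z [^] k)"
  proof (induction k)
    case (Suc k)
    then show ?case using P_mult[OF Suc P_z] by simp
  qed (simp add: P_one)
  then show ?thesis using P_unique_zero k by blast
qed

text \<open>Each commutator with \<open>a\<close> replaces the coefficient \<open>c\<close> by
  \<open>c e - c = c (e - 1)\<close>, which stays nonzero in a division ring since \<open>e\<close>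
  is not one.\<close>

lemma Q_iterated_commutator:
  "\<exists>c. c \<noteq> \<zero> \<and> Q c (((\<lambda>v. a \<otimes> v \<otimes> inv a \<otimes> inv v) ^^ n) b)"
proof (induction n)
  case 0
  then show ?case using Q_b one_not_zero by auto
next
  case (Suc n)
  then obtain c where c: "c \<noteq> \<zero>" "Q c (((\<lambda>v. a \<otimes> v \<otimes> inv a \<otimes> inv v) ^^ n) b)" by blast
  have car: "c \<in> carrier R" "e \<in> carrier R" using Q_K c B_carrier e_K by auto
  have "c \<otimes> e \<oplus> \<ominus> c \<noteq> \<zero>"
  proof
    assume "c \<otimes> e \<oplus> \<ominus> c = \<zero>"
    then have "c \<otimes> e = c \<otimes> \<one>" using car by (metis m_closed minus_eq r_one r_right_minus_eq)
    then show False using mult_left_cancel[of c e \<one>] c car e_neq_one by simp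
  qed
  then show ?case using Q_mult[OF Q_conj[OF c(2)] Q_inv[OF c(2)]] by auto
qed

text \<open>The \<open>k\<close>-th power has linear coefficient \<open>k c\<close>, whereas one has
  coefficient zero.\<close>

lemma iterated_commutator_not_torsion:
  assumes "add_pow R (k::nat) \<one> \<noteq> \<zero>"
  shows "((\<lambda>v. a \<otimes> v \<otimes> inv a \<otimes> inv v) ^^ n) b [^] k \<noteq> \<one>"
proof
  assume one: "((\<lambda>v. a \<otimes> v \<otimes> inv a \<otimes> inv v) ^^ n) b [^] k = \<one>"
  obtain c where c: "c \<noteq> \<zero>" "Q c (((\<lambda>v. a \<otimes> v \<otimes> inv a \<otimes> inv v) ^^ n) b)"
    using Q_iterated_commutator by blast
  have "add_pow R k c = \<zero>" using Q_one_unique Q_pow[OF c(2), of k] one by simp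
  then show False
    using mult_nonzero[of "add_pow R k \<one>" c] Q_K[OF c(2)] B_carrier c assms by (simp add: add_pow_ldistr)
qed

end

section \<open>Descent along an ascendant series\<close>

text \<open>Well-founded induction on the index of a member containing \<open>v\<close>. At a
  successor, normality puts \<open>v (inv a) (inv v)\<close>, and hence the commutator, into the
  preceding member; at a limit, \<open>v\<close> already lies in an earlier member.\<close>

lemma ascendant_iterated_commutator:
  fixes E :: "('a, 'b) monoid_scheme" (structure)
  assumes "group E" "ascendant G E" "a \<in> G" "v \<in> carrier E"
  shows "\<exists>n. ((\<lambda>v. a \<otimes> v \<otimes> inv a \<otimes> inv v) ^^ n) v \<in> G"
proof -
  interpret group E by fact
  obtain r :: "'a set rel" and \<gamma> Hs where "ascendant_series r \<gamma> Hs G E" using assms by (auto simp: ascendant_def)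
  then have wo: "Well_order r" and g: "\<gamma> \<in> Field r" and gmax: "\<And>\<alpha>. \<alpha> \<in> Field r \<Longrightarrow> (\<alpha>, \<gamma>) \<in> r"
    and sub: "\<And>\<alpha>. \<alpha> \<in> Field r \<Longrightarrow> subgroup (Hs \<alpha>) E"
    and H0: "Hs (wo_rel.minim r (Field r)) = G" and Hg: "Hs \<gamma> = carrier E"
    and Hsuc: "\<And>\<alpha>. \<alpha> \<in> underS r \<gamma> \<Longrightarrow> Hs \<alpha> \<lhd> E\<lparr>carrier := Hs (wo_rel.suc r {\<alpha>})\<rparr>"
    and Hlim: "\<And>l. limit_elem r l \<Longrightarrow> Hs l = (\<Union>\<alpha> \<in> underS r l. Hs \<alpha>)"
    unfolding ascendant_series_def by auto
  interpret r: wo_rel r by standard (rule wo)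
  have under: "\<beta> \<in> Field r" "\<beta> \<in> underS r \<gamma>" if "\<beta> \<in> underS r \<alpha>" "\<alpha> \<in> Field r" for \<alpha> \<beta>
  proof -
    show "\<beta> \<in> Field r" using that by (auto simp: underS_def Field_def)
    then show "\<beta> \<in> underS r \<gamma>"
      using that gmax r.ANTISYM by (auto simp: underS_def antisym_def)
  qed
  have cases: "\<alpha> = r.minim (Field r) \<or> limit_elem r \<alpha> \<or> (\<exists>\<beta>\<in>underS r \<alpha>. r.suc {\<beta>} = \<alpha>)"
    if \<alpha>: "\<alpha> \<in> Field r" for \<alpha>
  proof (cases "underS r \<alpha> = {}")
    case True
    have "(\<alpha>, \<beta>) \<in> r" if "\<beta> \<in> Field r" for \<beta>
      using True that \<alpha> r.in_notinI[of \<beta> \<alpha>] by (auto simp: underS_def)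
    then show ?thesis using r.equals_minim[of "Field r" \<alpha>] \<alpha> by blast
  next
    case False
    then show ?thesis using \<alpha> by (auto simp: limit_elem_def)
  qed
  \<comment> \<open>The descent needs \<open>a\<close> in every member, not only in the first
    one.\<close>
  have aH: "a \<in> Hs \<alpha>" if "\<alpha> \<in> Field r" for \<alpha>
    using that
  proof (induction \<alpha> rule: r.well_order_induct)
    case (1 \<alpha>)
    then have IH: "a \<in> Hs \<beta>" if "\<beta> \<in> underS r \<alpha>" for \<beta>
      using that under[OF that] by (auto simp: underS_def)
    from cases[OF 1(2)] show ?case
    proof (elim disjE bexE)
      assume "\<alpha> = r.minim (Field r)"
      then show ?thesis using H0 assms(3) by simp
    next
      assume l: "limit_elem r \<alpha>"
      then show ?thesis using IH Hlim[OF l] by (auto simp: limit_elem_def)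
    next
      fix \<beta> assume \<beta>: "\<beta> \<in> underS r \<alpha>" "r.suc {\<beta>} = \<alpha>"
      have "Hs \<beta> \<subseteq> Hs \<alpha>"
        using normal_imp_subgroup[OF Hsuc[OF under(2)[OF \<beta>(1) 1(2)]], THEN subgroup.subset] \<beta>(2) by simp
      then show ?thesis using IH[OF \<beta>(1)] by blast
    qed
  qed
  have "\<exists>n. ((\<lambda>v. a \<otimes> v \<otimes> inv a \<otimes> inv v) ^^ n) v \<in> G" if "\<alpha> \<in> Field r" "v \<in> Hs \<alpha>" for \<alpha> v
    using that
  proof (induction \<alpha> arbitrary: v rule: r.well_order_induct)
    case (1 \<alpha>)
    then have IH: "\<exists>n. ((\<lambda>v. a \<otimes> v \<otimes> inv a \<otimes> inv v) ^^ n) w \<in> G"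
      if "\<beta> \<in> underS r \<alpha>" "w \<in> Hs \<beta>" for \<beta> w
      using that under[OF that(1)] by (auto simp: underS_def)
    from cases[OF 1(2)] show ?case
    proof (elim disjE bexE)
      assume "\<alpha> = r.minim (Field r)"
      then show ?thesis using H0 1(3) by (intro exI[of _ 0]) simp
    next
      assume l: "limit_elem r \<alpha>"
      then show ?thesis using IH Hlim[OF l] 1(3) by auto
    next
      fix \<beta> assume \<beta>: "\<beta> \<in> underS r \<alpha>" "r.suc {\<beta>} = \<alpha>"
      note \<beta>F = under[OF \<beta>(1) 1(2)]
      note nrm = Hsuc[OF \<beta>F(2), unfolded \<beta>(2)]
      have sa: "subgroup (Hs \<alpha>) E" and sb: "subgroup (Hs \<beta>) E" using sub \<beta>F 1(2) by auto
      have car: "v \<in> carrier E" "a \<in> carrier E"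
        using subgroup.subset[OF sa] 1(3) aH[OF 1(2)] by auto
      have "inv a \<in> Hs \<beta>" using subgroup.m_inv_closed[OF sb aH[OF \<beta>F(1)]] .
      then have "v \<otimes> inv a \<otimes> inv v \<in> Hs \<beta>"
        using normal.inv_op_closed2[OF nrm, of v "inv a"] 1(3) m_inv_consistent[OF sa 1(3)] by simp
      then have "a \<otimes> (v \<otimes> inv a \<otimes> inv v) \<in> Hs \<beta>"
        using subgroup.m_closed[OF sb aH[OF \<beta>F(1)]] by blast
      then have "a \<otimes> v \<otimes> inv a \<otimes> inv v \<in> Hs \<beta>" using car by (simp add: m_assoc)
      then obtain n where "((\<lambda>v. a \<otimes> v \<otimes> inv a \<otimes> inv v) ^^ n) (a \<otimes> v \<otimes> inv a \<otimes> inv v) \<in> G"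
        using IH[OF \<beta>(1)] by blast
      then show ?thesis by (intro exI[of _ "Suc n"]) (simp add: funpow_Suc_right del: funpow.simps)
    qed
  qed
  then show ?thesis using g Hg assms(4) by blast
qed

lemma ascendant_subgroup:
  assumes "ascendant G E"
  shows "subgroup G E"
proof -
  obtain r :: "'a set rel" and \<gamma> Hs where *: "ascendant_series r \<gamma> Hs G E"
    using assms by (auto simp: ascendant_def)
  then interpret r: wo_rel r by unfold_locales (auto simp: ascendant_series_def)
  have "r.minim (Field r) \<in> Field r"
    using * by (intro r.minim_in) (auto simp: ascendant_series_def)
  then show ?thesis using * unfolding ascendant_series_def by blast
qed

section \<open>Torsion from local finiteness, and the conclusion\<close>

text \<open>Serves two groups: the additive group, giving positive characteristic, and the group of
  units, giving roots of unity.\<close>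

lemma (in group) finite_range_pow_imp_torsion:
  assumes x: "x \<in> carrier G" and fin: "finite (range (\<lambda>i::nat. x [^] i))"
  shows "\<exists>n::nat. n > 0 \<and> x [^] n = \<one>"
proof -
  have "\<not> inj (\<lambda>i::nat. x [^] i)" using fin finite_imageD infinite_UNIV_nat by blast
  then obtain i j :: nat where ij: "x [^] i = x [^] j" "i < j"
    unfolding inj_def by (metis linorder_neqE_nat)
  have "x [^] i \<otimes> x [^] (j - i) = x [^] j" using ij(2) x by (simp add: nat_pow_mult)
  then have "x [^] i \<otimes> x [^] (j - i) = x [^] i \<otimes> \<one>" using ij(1) x by simp
  then have "x [^] (j - i) = \<one>" using x by (simp del: r_one)
  then show ?thesis using ij by (intro exI[of _ "j - i"]) simp
qed

lemma locally_finite_field_torsion: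
  assumes "locally_finite_field K"
  shows "\<exists>N::nat. N > 0 \<and> add_pow K N \<one>\<^bsub>K\<^esub> = \<zero>\<^bsub>K\<^esub>"
    and "x \<in> carrier K \<Longrightarrow> x \<noteq> \<zero>\<^bsub>K\<^esub> \<Longrightarrow> \<exists>n::nat. n > 0 \<and> x [^]\<^bsub>K\<^esub> n = \<one>\<^bsub>K\<^esub>"
proof -
  interpret field K using assms by (simp add: locally_finite_field_def)
  have fin: "finite (generate_field K S)" if "S \<subseteq> carrier K" "finite S" for S
    using assms that by (simp add: locally_finite_field_def)
  \<comment> \<open>Zero is not among the generation rules of \<open>generate_field\<close>; it
    arises as one plus its negative.\<close>
  have zero: "\<zero>\<^bsub>K\<^esub> \<in> generate_field K S" if "S \<subseteq> carrier K" for S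
    using generate_field.eng_add[OF generate_field.one generate_field.a_inv[OF generate_field.one], of K S]
    by (simp add: r_neg)
  have add_in: "add_pow K (i::nat) \<one>\<^bsub>K\<^esub> \<in> generate_field K {}" for i
    by (induction i) (auto intro: zero generate_field.one generate_field.eng_add)
  have "finite (range (\<lambda>i::nat. add_pow K i \<one>\<^bsub>K\<^esub>))"
    by (rule finite_subset[OF _ fin[of "{}"]]) (use add_in in auto)
  then show "\<exists>N::nat. N > 0 \<and> add_pow K N \<one>\<^bsub>K\<^esub> = \<zero>\<^bsub>K\<^esub>"
    using add.finite_range_pow_imp_torsion[of "\<one>\<^bsub>K\<^esub>"] by simp
  assume x: "x \<in> carrier K" "x \<noteq> \<zero>\<^bsub>K\<^esub>"
  interpret M: group "units_of K" by (rule units_group)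
  have pow_in: "x [^]\<^bsub>K\<^esub> (i::nat) \<in> generate_field K {x}" for i
    by (induction i) (auto intro: generate_field.one generate_field.incl generate_field.eng_mult)
  have "finite (range (\<lambda>i::nat. x [^]\<^bsub>K\<^esub> i))"
    by (rule finite_subset[OF _ fin[of "{x}"]]) (use pow_in x in auto)
  then show "\<exists>n::nat. n > 0 \<and> x [^]\<^bsub>K\<^esub> n = \<one>\<^bsub>K\<^esub>"
    using M.finite_range_pow_imp_torsion[of x] x
    by (simp add: units_of_carrier field_Units units_of_pow units_of_one)
qed

theorem theorem4p5:
  fixes D :: "('a, 'b) ring_scheme" and F G :: "'a set"
  assumes "skew_field D"
    and "F = ring_center D"
    and "ascendant G (units_of D)"
    and "locally_finite_field (D\<lparr>carrier := F\<rparr>)"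
    and "radical_over D G F"
  shows "G \<subseteq> F"
proof
  interpret skew_field D by (rule assms(1))
  interpret U: group "units_of D" by (rule units_group)
  have "add_pow (D\<lparr>carrier := F\<rparr>) n x = add_pow D n x" for n :: nat and x
    by (simp add: add_pow_def nat_pow_def)
  then obtain N :: nat where N: "N > 0" "add_pow D N \<one>\<^bsub>D\<^esub> = \<zero>\<^bsub>D\<^esub>"
    using locally_finite_field_torsion(1)[OF assms(4)] by auto
  have G: "x \<in> carrier D" "x \<noteq> \<zero>\<^bsub>D\<^esub>" if "x \<in> G" for x
    using subgroup.subset[OF ascendant_subgroup[OF assms(3)]] that
    by (auto simp: units_of_carrier Units_iff)
  \<comment> \<open>\<open>x^m\<close> is a nonzero element of the locally finite center, hence a
    root of unity.\<close>
  have torsion: "\<exists>n::nat. n > 0 \<and> x [^]\<^bsub>D\<^esub> n = \<one>\<^bsub>D\<^esub>" if x: "x \<in> G" for x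
  proof -
    obtain m :: nat where m: "m > 0" "x [^]\<^bsub>D\<^esub> m \<in> F"
      using assms(5) x by (auto simp: radical_over_def)
    then obtain n :: nat where "n > 0" "(x [^]\<^bsub>D\<^esub> m) [^]\<^bsub>D\<^esub> n = \<one>\<^bsub>D\<^esub>"
      using locally_finite_field_torsion(2)[OF assms(4), of "x [^]\<^bsub>D\<^esub> m"] G[OF x] pow_nonzero
      by (auto simp flip: nat_pow_consistent)
    then show ?thesis using m G[OF x] by (intro exI[of _ "m * n"]) (simp add: nat_pow_pow)
  qed
  fix a assume aG: "a \<in> G"
  note a = G[OF aG]
  show "a \<in> F"
  proof (rule ccontr)
    assume "a \<notin> F"
    then obtain x where x: "x \<in> carrier D" "a \<otimes>\<^bsub>D\<^esub> x \<noteq> x \<otimes>\<^bsub>D\<^esub> a"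
      using a assms(2) centerI by blast
    obtain n :: nat where n: "n > 0" "a [^]\<^bsub>D\<^esub> n = \<one>\<^bsub>D\<^esub>" using torsion aG by blast
    \<comment> \<open>The eigenvector argument needs an exponent of \<open>a\<close> that is nonzero
      in \<open>D\<close>.\<close>
    obtain m :: nat where "a [^]\<^bsub>D\<^esub> m = \<one>\<^bsub>D\<^esub>" "add_pow D m \<one>\<^bsub>D\<^esub> \<noteq> \<zero>\<^bsub>D\<^esub>"
      using torsion_invertible_exponent[OF N a(1) n(2,1)] by blast
    then obtain y and i :: nat where y: "y \<in> carrier D" "y \<noteq> \<zero>\<^bsub>D\<^esub>"
      "y \<otimes>\<^bsub>D\<^esub> a = a [^]\<^bsub>D\<^esub> i \<otimes>\<^bsub>D\<^esub> y" "a [^]\<^bsub>D\<^esub> i \<noteq> a"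
      using exists_normalizing_element[OF a(1) _ _ x] by blast
    obtain K where K: "subring K D" "finite K" "a \<in> K"
      "\<And>c. c \<in> K \<Longrightarrow> a \<otimes>\<^bsub>D\<^esub> c = c \<otimes>\<^bsub>D\<^esub> a"
      "\<And>y i c. y \<in> carrier D \<Longrightarrow> y \<otimes>\<^bsub>D\<^esub> a = a [^]\<^bsub>D\<^esub> (i::nat) \<otimes>\<^bsub>D\<^esub> y \<Longrightarrow> c \<in> K \<Longrightarrow>
        \<exists>c'\<in>K. y \<otimes>\<^bsub>D\<^esub> c = c' \<otimes>\<^bsub>D\<^esub> y"
      using torsion_finite_subring[OF N a(1) n(2,1)] by metis
    interpret E: normalized_extension D K y a i
      by (intro normalized_extension.intro skew_extension.intro skew_field_axioms
          skew_extension_axioms.intro normalized_extension_axioms.intro K(1-4) K(5)[OF y(1,3)] y)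
    let ?f = "\<lambda>v. a \<otimes>\<^bsub>D\<^esub> v \<otimes>\<^bsub>D\<^esub> inv\<^bsub>D\<^esub> a \<otimes>\<^bsub>D\<^esub> inv\<^bsub>D\<^esub> v"
    \<comment> \<open>The series lives in \<open>units_of D\<close>, the coefficient calculus in
      \<open>D\<close>; \<open>?g\<close> and \<open>?f\<close> are the same commutator map on
      units.\<close>
    let ?g = "\<lambda>v. a \<otimes>\<^bsub>units_of D\<^esub> v \<otimes>\<^bsub>units_of D\<^esub> inv\<^bsub>units_of D\<^esub> a
      \<otimes>\<^bsub>units_of D\<^esub> inv\<^bsub>units_of D\<^esub> v"
    have aU: "a \<in> Units D" and bU: "E.b \<in> Units D" using a E.b by (auto simp: Units_iff)
    have fg: "(?g ^^ k) E.b = (?f ^^ k) E.b \<and> (?f ^^ k) E.b \<in> Units D" for k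
    proof (induction k)
      case (Suc k)
      then show ?case using aU by (auto simp: units_of_mult units_of_inv)
    qed (simp add: bU)
    obtain k where "(?g ^^ k) E.b \<in> G"
      using ascendant_iterated_commutator[OF U.is_group assms(3) aG, of E.b] bU
      by (auto simp: units_of_carrier)
    then have w: "(?f ^^ k) E.b \<in> G" using fg by simp
    obtain l :: nat where "l > 0" "(?f ^^ k) E.b [^]\<^bsub>D\<^esub> l = \<one>\<^bsub>D\<^esub>" using torsion[OF w] by blast
    \<comment> \<open>The exponent \<open>l\<close> may be divisible by the characteristic, which
      would hide the linear coefficient; \<open>q\<close> is not.\<close>
    then obtain q :: nat where "(?f ^^ k) E.b [^]\<^bsub>D\<^esub> q = \<one>\<^bsub>D\<^esub>" "add_pow D q \<one>\<^bsub>D\<^esub> \<noteq> \<zero>\<^bsub>D\<^esub>"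
      using torsion_invertible_exponent[OF N G(1)[OF w]] by blast
    then show False using E.iterated_commutator_not_torsion by blast
  qed
qed

end
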